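(* Let $(M;c)$ be a connected modular coloured matroid having a line with at least four points. Then $(M;c)$ is a target if and only if $(M|L;\,c|L)$ is a target for each line $L$ of $M$.
   Context: A coloured matroid $(M;c)$ is a (finite) matroid $M$ with a function $c$ on $E(M)$. $M$ is modular if $r_M(F)+r_M(F')=r_M(F\cup F')+r_M(F\cap F')$ for all flats $F,F'$. A point is a rank-one flat, a line a rank-two flat; a line has at least four points if it contains at least four rank-one flats. $(M;c)$ is a target if there are flats $\mathrm{cl}_M(\varnothing)=F_0\subseteq F_1\subseteq\dots\subseteq F_k=E(M)$ such that every nonempty set among $F_0$ and the sets $F_{i+1}-F_i$ is monochromatic under $c$. *)

theory Defs
  imports Main "HOL-Library.FuncSet"
begin

record 'a matroid_struct =
  ground :: "'a set"
  indeps :: "'a set set"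

definition matroid :: "'a matroid_struct \<Rightarrow> bool" where
  "matroid M \<longleftrightarrow>
     finite (ground M) \<and>
     indeps M \<subseteq> Pow (ground M) \<and>
     {} \<in> indeps M \<and>
     (\<forall>I J. J \<in> indeps M \<longrightarrow> I \<subseteq> J \<longrightarrow> I \<in> indeps M) \<and>
     (\<forall>I J. I \<in> indeps M \<longrightarrow> J \<in> indeps M \<longrightarrow> card I < card J \<longrightarrow>
        (\<exists>e\<in>J - I. insert e I \<in> indeps M))"

definition matroid_rank :: "'a matroid_struct \<Rightarrow> 'a set \<Rightarrow> nat" where
  "matroid_rank M X = Max (card ` {I \<in> indeps M. I \<subseteq> X})"

definition matroid_cl :: "'a matroid_struct \<Rightarrow> 'a set \<Rightarrow> 'a set" where
  "matroid_cl M X = {e \<in> ground M. matroid_rank M (insert e X) = matroid_rank M X}"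

definition matroid_flat :: "'a matroid_struct \<Rightarrow> 'a set \<Rightarrow> bool" where
  "matroid_flat M F \<longleftrightarrow> F \<subseteq> ground M \<and> matroid_cl M F = F"

definition matroid_point :: "'a matroid_struct \<Rightarrow> 'a set \<Rightarrow> bool" where
  "matroid_point M P \<longleftrightarrow> matroid_flat M P \<and> matroid_rank M P = 1"

definition matroid_line :: "'a matroid_struct \<Rightarrow> 'a set \<Rightarrow> bool" where
  "matroid_line M L \<longleftrightarrow> matroid_flat M L \<and> matroid_rank M L = 2"

definition matroid_circuit :: "'a matroid_struct \<Rightarrow> 'a set \<Rightarrow> bool" where
  "matroid_circuit M C \<longleftrightarrow>
     C \<subseteq> ground M \<and> C \<notin> indeps M \<and> (\<forall>D. D \<subset> C \<longrightarrow> D \<in> indeps M)"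

definition matroid_connected :: "'a matroid_struct \<Rightarrow> bool" where
  "matroid_connected M \<longleftrightarrow>
     (\<forall>e\<in>ground M. \<forall>f\<in>ground M. e \<noteq> f \<longrightarrow>
        (\<exists>C. matroid_circuit M C \<and> e \<in> C \<and> f \<in> C))"

definition matroid_modular :: "'a matroid_struct \<Rightarrow> bool" where
  "matroid_modular M \<longleftrightarrow>
     (\<forall>F F'. matroid_flat M F \<longrightarrow> matroid_flat M F' \<longrightarrow>
        matroid_rank M F + matroid_rank M F' =
        matroid_rank M (F \<union> F') + matroid_rank M (F \<inter> F'))"

definition matroid_restrict :: "'a matroid_struct \<Rightarrow> 'a set \<Rightarrow> 'a matroid_struct" where
  "matroid_restrict M X = \<lparr>ground = X, indeps = {I \<in> indeps M. I \<subseteq> X}\<rparr>"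

lemma matroid_matroid_restrict:
  assumes M: "matroid M" and X: "X \<subseteq> ground M"
  shows "matroid (matroid_restrict M X)"
proof -
  note M' = M[unfolded matroid_def]
  have fin: "finite X"
    using conjunct1[OF M'] X by (rule finite_subset[rotated])
  have empty: "{} \<in> indeps M"
    using M' by (elim conjE)
  have down: "\<forall>I J. J \<in> indeps M \<longrightarrow> I \<subseteq> J \<longrightarrow> I \<in> indeps M"
    using M' by (elim conjE)
  have aug: "\<forall>I J. I \<in> indeps M \<longrightarrow> J \<in> indeps M \<longrightarrow> card I < card J \<longrightarrow>
      (\<exists>e\<in>J - I. insert e I \<in> indeps M)"
    using M' by (elim conjE)
  let ?I = "{I \<in> indeps M. I \<subseteq> X}"
  have down': "I \<in> ?I" if "J \<in> ?I" "I \<subseteq> J" for I J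
    using down[rule_format, of J I] that by auto
  have aug': "\<exists>e\<in>J - I. insert e I \<in> ?I"
    if I: "I \<in> ?I" and J: "J \<in> ?I" and card: "card I < card J" for I J
  proof -
    obtain e where e: "e \<in> J - I" "insert e I \<in> indeps M"
      using aug[rule_format, of I J] I J card by auto
    then have "insert e I \<subseteq> X"
      using I J by auto
    with e show ?thesis
      by auto
  qed
  have pow: "?I \<subseteq> Pow X"
    by auto
  have empty': "{} \<in> ?I"
    using empty by simp
  show ?thesis
    unfolding matroid_def matroid_restrict_def matroid_struct.simps
    by (intro conjI allI impI) (fact fin, fact pow, fact empty', erule (1) down', erule (2) aug')
qed

definition monochromatic :: "('a \<Rightarrow> 'c) \<Rightarrow> 'a set \<Rightarrow> bool" where
  "monochromatic c X \<longleftrightarrow> (\<exists>a. \<forall>x\<in>X. c x = a)"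

text \<open>A colouring is a total function, of which only the values on the ground set
  of the matroid matter.\<close>

definition is_target :: "'a matroid_struct \<Rightarrow> ('a \<Rightarrow> 'c) \<Rightarrow> bool" where
  "is_target M c \<longleftrightarrow>
     (\<exists>(k::nat) F.
        F 0 = matroid_cl M {} \<and> F k = ground M \<and>
        (\<forall>i\<le>k. matroid_flat M (F i)) \<and>
        (\<forall>i<k. F i \<subseteq> F (Suc i)) \<and>
        (\<forall>X \<in> insert (F 0) {F (Suc i) - F i | i. i < k}.
            X \<noteq> {} \<longrightarrow> monochromatic c X))"

end

theory Submission
  imports Defs
begin

text \<open>
  Work in the modular lattice of flats. Perspectivities turn the single line with four points into
  the statement that all lines have at least four points. A target line has a majority colour,
  attained by all its points but at most one. In a plane all of whose lines are targets, all lines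
  but at most one have the same majority colour.

  Every flat F of positive rank then has a hyperplane H with F - H monochromatic, by induction on
  the rank of F. For a point x of F choose a hyperplane of F missing x and colour each of its points
  y by the majority colour of the line xy; by the plane case this colouring again makes every line
  a target. The induction hypothesis yields a hyperplane K of F through x such that all lines of F
  through x outside K have the same majority colour, and a second use of the plane case shows that
  this colour a does not depend on x. If F is not monochromatic in a, choose x of a different
  colour: every line through x outside K has its exceptional point at x, so F - K has colour a.
  Iterating from the whole matroid downwards gives the chain of flats.
\<close>

section \<open>Modular lattices of flats\<close>

text \<open>The flats are a carrier set inside an ambient meet-semilattice and are closed under
  \<open>inf\<close>, the intersection. The join of two flats is the closure of their union, hence
  the parameter \<open>jn\<close>, which \<open>jn_le_iff\<close> makes a least upper bound. By
  \<open>atom\<close>, points separate flats.\<close>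

locale modular_flats =
  fixes FL :: "'a :: semilattice_inf set" and jn :: "'a \<Rightarrow> 'a \<Rightarrow> 'a" and rk :: "'a \<Rightarrow> nat"
  assumes inf_FL [simp]: "\<lbrakk>A \<in> FL; B \<in> FL\<rbrakk> \<Longrightarrow> inf A B \<in> FL"
    and jn_FL [simp]: "\<lbrakk>A \<in> FL; B \<in> FL\<rbrakk> \<Longrightarrow> jn A B \<in> FL"
    and jn_le_iff [simp]: "\<lbrakk>A \<in> FL; B \<in> FL; C \<in> FL\<rbrakk> \<Longrightarrow> jn A B \<le> C \<longleftrightarrow> A \<le> C \<and> B \<le> C"
    and modular: "\<lbrakk>A \<in> FL; B \<in> FL\<rbrakk> \<Longrightarrow> rk A + rk B = rk (jn A B) + rk (inf A B)"
    and rk_strict: "\<lbrakk>A \<in> FL; B \<in> FL; A < B\<rbrakk> \<Longrightarrow> rk A < rk B"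
    and atom: "\<lbrakk>A \<in> FL; B \<in> FL; \<not> B \<le> A\<rbrakk> \<Longrightarrow> \<exists>x\<in>FL. rk x = 1 \<and> x \<le> B \<and> \<not> x \<le> A"
    and bottom: "\<exists>Z\<in>FL. rk Z = 0"
begin

definition pt :: "'a \<Rightarrow> bool" where "pt x \<longleftrightarrow> x \<in> FL \<and> rk x = 1"
definition ln :: "'a \<Rightarrow> bool" where "ln L \<longleftrightarrow> L \<in> FL \<and> rk L = 2"

lemma pt_FL [simp]: "pt x \<Longrightarrow> x \<in> FL" and pt_rk [simp]: "pt x \<Longrightarrow> rk x = 1"
  and ln_FL [simp]: "ln L \<Longrightarrow> L \<in> FL" and ln_rk [simp]: "ln L \<Longrightarrow> rk L = 2"
  by (auto simp: pt_def ln_def)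

lemma le_jn [simp]: "\<lbrakk>A \<in> FL; B \<in> FL\<rbrakk> \<Longrightarrow> A \<le> jn A B" "\<lbrakk>A \<in> FL; B \<in> FL\<rbrakk> \<Longrightarrow> B \<le> jn A B"
  using jn_le_iff[of A B "jn A B"] jn_FL[of A B] order.refl[of "jn A B"] by blast+

lemma obtain_pt:
  assumes "A \<in> FL" "B \<in> FL" "\<not> B \<le> A" obtains x where "pt x" "x \<le> B" "\<not> x \<le> A"
  using atom[OF assms] unfolding pt_def by blast

lemma rk_mono: "\<lbrakk>A \<in> FL; B \<in> FL; A \<le> B\<rbrakk> \<Longrightarrow> rk A \<le> rk B"
  by (metis order_le_less rk_strict)

lemma rk_not_le: "\<lbrakk>A \<in> FL; B \<in> FL; rk B < rk A\<rbrakk> \<Longrightarrow> \<not> A \<le> B"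
  using rk_mono by fastforce

lemma flat_eqI: "\<lbrakk>A \<in> FL; B \<in> FL; A \<le> B; rk B \<le> rk A\<rbrakk> \<Longrightarrow> A = B"
  by (metis leD order_le_less rk_strict)

lemma pt_le_eq: "\<lbrakk>pt x; pt y; x \<le> y\<rbrakk> \<Longrightarrow> x = y"
  by (rule flat_eqI) auto

lemma ln_le_eq: "\<lbrakk>ln L; ln K; L \<le> K\<rbrakk> \<Longrightarrow> L = K"
  by (rule flat_eqI) auto

lemma pt_meet:
  assumes "pt x" "A \<in> FL" "\<not> x \<le> A" shows "rk (inf x A) = 0"
proof -
  have "inf x A \<noteq> x" using assms(3) inf.cobounded2[of x A] by metis
  then have "inf x A < x" by (simp add: less_le)
  then have "rk (inf x A) < rk x" using assms by (intro rk_strict) auto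
  then show ?thesis using assms by simp
qed

lemma pt_join: "\<lbrakk>pt x; A \<in> FL; \<not> x \<le> A\<rbrakk> \<Longrightarrow> rk (jn x A) = Suc (rk A)"
  using modular[of x A] pt_meet[of x A] by simp

lemma ln_join: "\<lbrakk>pt x; pt y; x \<noteq> y\<rbrakk> \<Longrightarrow> ln (jn x y)"
  using pt_join[of x y] pt_le_eq[of x y] unfolding ln_def by (cases "x \<le> y") simp_all

lemma ln_eq_join:
  "\<lbrakk>ln L; pt x; pt y; x \<noteq> y; x \<le> L; y \<le> L\<rbrakk> \<Longrightarrow> jn x y = L"
  using ln_join[of x y] by (intro flat_eqI) simp_all

lemma ln_unique:
  "\<lbrakk>ln L; ln K; pt x; pt y; x \<noteq> y; x \<le> L; y \<le> L; x \<le> K; y \<le> K\<rbrakk> \<Longrightarrow> L = K"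
  using ln_eq_join by metis

text \<open>Since \<open>A\<close> is not below \<open>H\<close>, the join of the two lies strictly
  above \<open>H\<close> and has the rank of \<open>F\<close>; the modular law does the
  rest.\<close>

lemma meet_hyperplane:
  assumes "A \<in> FL" "H \<in> FL" "F \<in> FL" "A \<le> F" "H \<le> F" "rk F = Suc (rk H)" "\<not> A \<le> H"
  shows "rk A = Suc (rk (inf A H))"
proof -
  have "H < jn A H" using assms by (metis le_jn order_le_less)
  then have "rk H < rk (jn A H)" using assms by (intro rk_strict) auto
  moreover have "rk (jn A H) \<le> rk F" using assms by (intro rk_mono) auto
  ultimately show ?thesis using modular[of A H] assms by simp
qed

lemma ln_meet_hyperplane:
  "\<lbrakk>ln L; H \<in> FL; F \<in> FL; L \<le> F; H \<le> F; rk F = Suc (rk H); \<not> L \<le> H\<rbrakk> \<Longrightarrow> pt (inf L H)"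
  using meet_hyperplane[of L H F] unfolding pt_def by simp

lemma plane_meet:
  "\<lbrakk>R \<in> FL; rk R = 3; ln L; ln K; L \<le> R; K \<le> R; L \<noteq> K\<rbrakk> \<Longrightarrow> pt (inf L K)"
  using ln_le_eq[of L K] by (intro ln_meet_hyperplane[of L K R]) auto

text \<open>\<open>H\<close> is a flat of maximal rank below \<open>F\<close> that misses
  \<open>x\<close>. A point \<open>y\<close> of \<open>F\<close> off \<open>jn x H\<close> would, by
  maximality, put \<open>x\<close> on \<open>jn y H\<close>; this flat would then equal
  \<open>jn x H\<close> by rank and contain \<open>y\<close>.\<close>

lemma hyperplane_avoiding:
  assumes F: "F \<in> FL" and x: "pt x" "x \<le> F"
  obtains H where "H \<in> FL" "H \<le> F" "\<not> x \<le> H" "rk F = Suc (rk H)"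
proof -
  let ?P = "\<lambda>H. H \<in> FL \<and> H \<le> F \<and> \<not> x \<le> H"
  obtain Z where Z: "Z \<in> FL" "rk Z = 0" using bottom by auto
  have "rk (inf Z F) \<le> rk Z" using Z F by (intro rk_mono) auto
  then have "\<not> x \<le> inf Z F" using x Z F by (intro rk_not_le) auto
  then have "\<exists>H. ?P H \<and> (\<forall>H'. ?P H' \<longrightarrow> rk H' \<le> rk H)"
    using Z F rk_mono[of _ F]
    by (intro ex_has_greatest_nat[of ?P "inf Z F" rk "Suc (rk F)"]) (auto intro: le_imp_less_Suc)
  then obtain H where HF: "H \<in> FL" "H \<le> F" "\<not> x \<le> H"
    and max: "\<And>H'. ?P H' \<Longrightarrow> rk H' \<le> rk H"
    by (elim exE conjE) blast
  have xH: "rk (jn x H) = Suc (rk H)" using HF x by (intro pt_join) auto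
  have sub: "jn x H \<le> F" using HF x F by simp
  have "F \<le> jn x H"
  proof (rule ccontr)
    assume "\<not> F \<le> jn x H"
    then obtain y where y: "pt y" "y \<le> F" "\<not> y \<le> jn x H"
      using obtain_pt[of "jn x H" F] F HF x by auto
    have "\<not> y \<le> H" using y HF x by (meson le_jn(2) order.trans pt_FL)
    then have yH: "rk (jn y H) = Suc (rk H)" using HF y by (intro pt_join) auto
    then have "\<not> ?P (jn y H)" using max by fastforce
    then have "x \<le> jn y H" using HF y F by auto
    then have "jn x H = jn y H" using HF y x xH yH by (intro flat_eqI) auto
    then show False using y le_jn(1)[of y H] HF by auto
  qed
  then have "jn x H = F" using sub by simp
  then show ?thesis using that[of H] HF xH by auto
qed

end

section \<open>Hyperplanes and perspectivities when every line has a third point\<close>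

locale three_pt_flats = modular_flats +
  assumes third: "\<lbrakk>pt x; pt y; x \<noteq> y\<rbrakk> \<Longrightarrow> \<exists>z. pt z \<and> z \<le> jn x y \<and> z \<noteq> x \<and> z \<noteq> y"
begin

text \<open>For distinct hyperplanes, join a point of \<open>H\<close> off \<open>K\<close> to a
  point of \<open>K\<close> off \<open>H\<close>. The third point of that line lies on neither,
  since otherwise the whole line would.\<close>

lemma hyperplanes_not_cover:
  assumes F: "F \<in> FL" and H: "H \<in> FL" "H \<le> F" "rk F = Suc (rk H)"
    and K: "K \<in> FL" "K \<le> F" "rk F = Suc (rk K)"
  obtains z where "pt z" "z \<le> F" "\<not> z \<le> H" "\<not> z \<le> K"
proof (cases "H = K")
  case True
  then have "\<not> F \<le> H" using H F by (intro rk_not_le) auto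
  then show ?thesis using obtain_pt[of H F] that True F H by auto
next
  case False
  have "\<not> H \<le> K" "\<not> K \<le> H"
    using False flat_eqI[of H K] flat_eqI[of K H] H K by auto
  then obtain u v where u: "pt u" "u \<le> H" "\<not> u \<le> K" and v: "pt v" "v \<le> K" "\<not> v \<le> H"
    using obtain_pt H K by metis
  then have uv: "u \<noteq> v" by auto
  then obtain z where z: "pt z" "z \<le> jn u v" "z \<noteq> u" "z \<noteq> v" using third u v by blast
  have l: "ln (jn u v)" using u v uv ln_join by auto
  have e: "jn u z = jn u v" "jn v z = jn u v"
    using l z u v uv by (auto intro!: ln_eq_join)
  have "\<not> z \<le> H" using jn_le_iff[of u z H] e jn_le_iff[of u v H] u v z H by auto
  moreover have "\<not> z \<le> K" using jn_le_iff[of v z K] e jn_le_iff[of u v K] u v z K by auto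
  moreover have "u \<le> F" "v \<le> F" using u(2) v(2) H(2) K(2) by (metis order.trans)+
  then have "jn u v \<le> F" using u v F by simp
  then have "z \<le> F" using z(2) by (metis order.trans)
  ultimately show ?thesis using that z by auto
qed

text \<open>At least four points, expressed without cardinalities. The avoided \<open>x\<close>,
  \<open>y\<close>, \<open>z\<close> may coincide or fail to be points, so exceptions and meets can
  be excluded without case distinctions.\<close>

definition rich :: "'a \<Rightarrow> bool" where
  "rich L \<longleftrightarrow> (\<forall>x y z. \<exists>w. pt w \<and> w \<le> L \<and> w \<noteq> x \<and> w \<noteq> y \<and> w \<noteq> z)"

lemma richE:
  assumes "rich L" obtains w where "pt w" "w \<le> L" "w \<noteq> x" "w \<noteq> y" "w \<noteq> z"
  using assms unfolding rich_def by metis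

lemma other_pt:
  assumes "ln K" "pt s" obtains k where "pt k" "k \<le> K" "k \<noteq> s"
proof -
  have "\<not> K \<le> s" using assms by (intro rk_not_le) auto
  then obtain k where "pt k" "k \<le> K" "\<not> k \<le> s" using obtain_pt[of s K] assms by auto
  then show ?thesis using that[of k] by auto
qed

text \<open>Project from a third point n of a line joining the two lines.\<close>

lemma rich_perspective:
  assumes L: "ln L" "rich L" and K: "ln K" and s: "pt s" "s \<le> L" "s \<le> K"
  shows "rich K"
proof (cases "L = K")
  case False
  obtain l where l: "pt l" "l \<le> L" "l \<noteq> s" using other_pt[OF L(1) s(1)] by metis
  obtain k where k: "pt k" "k \<le> K" "k \<noteq> s" using other_pt[OF K s(1)] by metis
  have lK: "\<not> l \<le> K" using ln_unique[OF L(1) K l(1) s(1) l(3)] False l(2) s by blast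
  have kL: "\<not> k \<le> L" using ln_unique[OF L(1) K k(1) s(1) k(3)] False k(2) s by blast
  have "l \<noteq> k" using k(2) lK by auto
  then obtain n where n: "pt n" "n \<le> jn l k" "n \<noteq> l" "n \<noteq> k"
    using third[OF l(1) k(1)] by blast
  have lk: "ln (jn l k)" using ln_join[OF l(1) k(1) \<open>l \<noteq> k\<close>] .
  have lk': "l \<le> jn l k" "k \<le> jn l k" using l k by auto
  have nL: "\<not> n \<le> L" using ln_unique[OF L(1) lk n(1) l(1) n(3)] l(2) n(2) lk' kL by blast
  have nK: "\<not> n \<le> K" using ln_unique[OF K lk n(1) k(1) n(4)] k(2) n(2) lk' lK by blast
  define R where "R = jn l K"
  have R: "R \<in> FL" "rk R = 3" "K \<le> R" "l \<le> R"
    using pt_join[of l K] lK l K by (auto simp: R_def)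
  have "L = jn l s" using ln_eq_join[of L l s] l s L by auto
  then have LR: "L \<le> R" using R l(1) s K order.trans[OF s(3) R(3)] by simp
  have "jn l k \<le> R" using l(1) k R order.trans[OF k(2) R(3)] by simp
  then have nR: "n \<le> R" using n(2) by (metis order.trans)
  \<comment> \<open>Projection from \<open>n\<close> in the plane \<open>R\<close>, carrying points
    of \<open>Y\<close> to points of \<open>X\<close>. It is stated so as to serve both directions,
    from \<open>K\<close> to \<open>L\<close> and back.\<close>
  have proj: "pt (inf (jn n x) X)" "ln (jn n x)" "n \<le> jn n x" "x \<le> jn n x" "n \<noteq> x"
    if "ln X" "pt x" "x \<le> Y" "X \<le> R" "Y \<le> R" "\<not> n \<le> X" "\<not> n \<le> Y" for x X Y
  proof -
    show nx: "n \<noteq> x" using that by auto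
    show l: "ln (jn n x)" using n that nx ln_join by auto
    show le: "n \<le> jn n x" "x \<le> jn n x" using n that by auto
    have "x \<le> R" using that(3,5) by (rule order.trans)
    then have "jn n x \<le> R" using that R nR n by auto
    then show "pt (inf (jn n x) X)" using l le that R by (intro plane_meet[of R]) auto
  qed
  show ?thesis unfolding rich_def
  proof (intro allI)
    fix x y z
    let ?f = "\<lambda>x. inf (jn n x) L"
    \<comment> \<open>A point \<open>w\<close> of \<open>L\<close> besides the images of
      \<open>x\<close>, \<open>y\<close>, \<open>z\<close> is projected back to \<open>?w\<close> on
      \<open>K\<close>; \<open>?f ?w = w\<close> keeps \<open>?w\<close> apart from all
      three.\<close>
    obtain w where w: "pt w" "w \<le> L" "w \<noteq> ?f x" "w \<noteq> ?f y" "w \<noteq> ?f z"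
      using richE[OF L(2)] by metis
    let ?w = "inf (jn n w) K"
    note pw = proj[of K w L, OF K w(1,2) R(3) LR nK nL]
    note p = proj[of L ?w K, OF L(1) pw(1) _ LR R(3) nL nK, simplified]
    have "jn n ?w = jn n w" using p pw n by (intro ln_unique[of "jn n ?w" "jn n w" n ?w]) auto
    then have "w \<le> ?f ?w" using pw w by auto
    then have "?f ?w = w" using pt_le_eq[of w "?f ?w"] p w by auto
    then show "\<exists>w. pt w \<and> w \<le> K \<and> w \<noteq> x \<and> w \<noteq> y \<and> w \<noteq> z"
      using w pw by (intro exI[of _ ?w]) auto
  qed
qed (use L in simp)

text \<open>Two perspectivities suffice: from \<open>L\<close> to a line joining a point of
  \<open>L\<close> to a point of \<open>K\<close>, and from there to \<open>K\<close>.\<close>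

lemma all_rich:
  assumes L: "ln L" "rich L" and K: "ln K"
  shows "rich K"
proof -
  obtain l where l: "pt l" "l \<le> L" using richE[OF L(2)] by metis
  obtain k where k: "pt k" "k \<le> K" "k \<noteq> l" using other_pt[OF K l(1)] by metis
  have "ln (jn l k)" using l k ln_join by blast
  moreover have "l \<le> jn l k" "k \<le> jn l k" using l k by auto
  ultimately show ?thesis
    using rich_perspective[of L "jn l k" l] rich_perspective[of "jn l k" K k] L K l k by auto
qed

end

section \<open>Lattices with at least four points on every line\<close>

locale rich_flats = three_pt_flats +
  assumes rich: "ln L \<Longrightarrow> rich L"
begin

subsection \<open>Majority colours in planes\<close>

text \<open>The exception \<open>p\<close> may be any element and its colour is free, so lines of a
  single colour are included.\<close>

definition maj :: "('a \<Rightarrow> 'c) \<Rightarrow> 'a \<Rightarrow> 'c \<Rightarrow> bool" where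
  "maj d L a \<longleftrightarrow> (\<exists>p. \<forall>x. pt x \<longrightarrow> x \<le> L \<longrightarrow> x \<noteq> p \<longrightarrow> d x = a)"

lemma maj_other: "\<lbrakk>maj d L a; pt x; pt y; x \<le> L; y \<le> L; x \<noteq> y; d x \<noteq> a\<rbrakk> \<Longrightarrow> d y = a"
  unfolding maj_def by metis

lemma maj_unique:
  assumes "ln L" "maj d L a" "maj d L b" shows "a = b"
proof -
  obtain p q where "\<And>x. \<lbrakk>pt x; x \<le> L; x \<noteq> p\<rbrakk> \<Longrightarrow> d x = a" "\<And>x. \<lbrakk>pt x; x \<le> L; x \<noteq> q\<rbrakk> \<Longrightarrow> d x = b"
    using assms unfolding maj_def by metis
  moreover obtain w where "pt w" "w \<le> L" "w \<noteq> p" "w \<noteq> q" using richE[OF rich[OF assms(1)]] by metis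
  ultimately show ?thesis by metis
qed

lemma maj_two: "\<lbrakk>maj d L e; pt x; pt y; x \<le> L; y \<le> L; x \<noteq> y; d x = a; d y = a\<rbrakk> \<Longrightarrow> maj d L a"
  using maj_other by metis

lemma pt_eq_of_lines:
  "\<lbrakk>ln L; ln K; L \<noteq> K; pt x; pt y; x \<le> L; y \<le> L; x \<le> K; y \<le> K\<rbrakk> \<Longrightarrow> x = y"
  using ln_unique by metis

text \<open>Assume that a point \<open>n\<close> off both lines is not coloured \<open>a\<close>.
  Lines from \<open>n\<close> to points of \<open>K\<close> coloured \<open>b\<close> meet
  \<open>L\<close> in a point coloured \<open>a\<close>, which becomes their only exception; so
  \<open>b\<close> spreads over all points off \<open>L\<close>. Without such an \<open>n\<close>,
  everything off \<open>K\<close> has colour \<open>a\<close>.\<close>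

lemma plane_majority_aux:
  assumes R: "R \<in> FL" "rk R = 3" and tgt: "\<And>N. \<lbrakk>ln N; N \<le> R\<rbrakk> \<Longrightarrow> \<exists>e. maj d N e"
    and L: "ln L" "L \<le> R" and K: "ln K" "K \<le> R" and LK: "L \<noteq> K"
    and dL: "\<And>x. \<lbrakk>pt x; x \<le> L; \<not> x \<le> K\<rbrakk> \<Longrightarrow> d x = a" and dK: "maj d K b" and ab: "a \<noteq> b"
  shows "(\<forall>x. pt x \<longrightarrow> x \<le> R \<longrightarrow> \<not> x \<le> L \<longrightarrow> d x = b) \<or>
         (\<forall>x. pt x \<longrightarrow> x \<le> R \<longrightarrow> \<not> x \<le> K \<longrightarrow> d x = a)"
proof (cases "\<forall>x. pt x \<longrightarrow> x \<le> R \<longrightarrow> \<not> x \<le> L \<longrightarrow> \<not> x \<le> K \<longrightarrow> d x = a")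
  case True
  then show ?thesis using dL by metis
next
  case False
  then obtain n where n: "pt n" "n \<le> R" "\<not> n \<le> L" "\<not> n \<le> K" "d n \<noteq> a" by metis
  define s where "s = inf L K"
  have s: "pt s" "s \<le> L" "s \<le> K" using plane_meet[OF R L(1) K(1) L(2) K(2) LK] by (auto simp: s_def)
  have sI: "x = s" if "pt x" "x \<le> L" "x \<le> K" for x
    using pt_eq_of_lines[OF L(1) K(1) LK that(1) s(1)] that s by metis
  obtain p where p: "\<And>x. \<lbrakk>pt x; x \<le> K; x \<noteq> p\<rbrakk> \<Longrightarrow> d x = b" using dK unfolding maj_def by metis
  have line: "ln (jn u v)" "jn u v \<le> R" "u \<le> jn u v" "v \<le> jn u v"
    if "pt u" "pt v" "u \<noteq> v" "u \<le> R" "v \<le> R" for u v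
    using ln_join[OF that(1-3)] that R(1) by simp_all
  have meetL: "pt (inf N L)" "inf N L \<le> N" "inf N L \<le> L" "\<not> inf N L \<le> K" "d (inf N L) = a"
    if "ln N" "N \<le> R" "\<not> s \<le> N" for N
  proof -
    have "N \<noteq> L" using that s by metis
    then show *: "pt (inf N L)" "inf N L \<le> N" "inf N L \<le> L"
      using plane_meet[OF R that(1) L(1) that(2) L(2)] by auto
    show "\<not> inf N L \<le> K" using sI[OF *(1,3)] * that by metis
    then show "d (inf N L) = a" using dL * by metis
  qed
  \<comment> \<open>The meet of \<open>N\<close> with \<open>L\<close> has colour \<open>a\<close>
    and uses up the only exception of \<open>N\<close>.\<close>
  have spread: "d x = b"
    if "ln N" "N \<le> R" "\<not> s \<le> N" "pt u" "pt v" "u \<noteq> v" "u \<le> N" "v \<le> N" "d u = b" "d v = b"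
      "pt x" "x \<le> N" "\<not> x \<le> L" for N u v x
  proof -
    have "maj d N b" using tgt[OF that(1,2)] maj_two that by metis
    then show ?thesis
      using maj_other[OF _ meetL(1)[OF that(1-3)] that(11) meetL(2)[OF that(1-3)] that(12)]
        meetL(3,5)[OF that(1-3)] that ab by metis
  qed
  have KR: "k \<le> R" if "k \<le> K" for k using that K(2) by (rule order.trans)
  have off_s: "\<not> s \<le> jn m k" "jn m k \<noteq> K" "ln (jn m k)" "jn m k \<le> R" "m \<le> jn m k" "k \<le> jn m k" "m \<noteq> k"
    if "pt m" "m \<le> R" "\<not> m \<le> K" "pt k" "k \<le> K" "k \<noteq> s" for m k
  proof -
    show "m \<noteq> k" using that by metis
    then show l: "ln (jn m k)" "jn m k \<le> R" "m \<le> jn m k" "k \<le> jn m k"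
      using line[of m k] that KR by auto
    then show "jn m k \<noteq> K" using that by metis
    then show "\<not> s \<le> jn m k"
      using pt_eq_of_lines[OF l(1) K(1) _ that(4) s(1)] l that s by metis
  qed
  \<comment> \<open>\<open>k1\<close> and \<open>k2\<close> avoid both \<open>s\<close> and the
    exception \<open>p\<close> of \<open>K\<close>; finding the second takes a fourth point.\<close>
  obtain k1 where k1: "pt k1" "k1 \<le> K" "k1 \<noteq> s" "k1 \<noteq> p" using richE[OF rich[OF K(1)]] by metis
  obtain k2 where k2: "pt k2" "k2 \<le> K" "k2 \<noteq> s" "k2 \<noteq> p" "k2 \<noteq> k1"
    using richE[OF rich[OF K(1)]] by metis
  have dk: "d k1 = b" "d k2 = b" using p k1 k2 by auto
  have KL: "\<not> k \<le> L" if "pt k" "k \<le> K" "k \<noteq> s" for k using sI that by metis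
  \<comment> \<open>The points \<open>n\<close>, \<open>k1\<close> and the meet with
    \<open>L\<close> lie on one target line. Majority \<open>a\<close> would make both
    \<open>n\<close> and \<open>k1\<close> exceptions, so the majority is \<open>b\<close> and the
    meet is the exception.\<close>
  have dn: "d n = b"
  proof -
    note N = off_s[OF n(1,2,4) k1(1-3)]
    note h = meetL[OF N(3,4,1)]
    obtain e where e: "maj d (jn n k1) e" using tgt N by metis
    have "inf (jn n k1) L \<noteq> k1" "inf (jn n k1) L \<noteq> n" using h k1 n by metis+
    then have "e = a \<or> e = b" using maj_other[OF e h(1) k1(1) h(2) N(6)] h dk by metis
    then have "e = b" using maj_other[OF e k1(1) n(1) N(6,5)] N(7) dk ab n(5) by metis
    then show ?thesis
      using maj_other[OF e h(1) n(1) h(2) N(5)] h(5) ab \<open>inf (jn n k1) L \<noteq> n\<close> by metis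
  qed
  \<comment> \<open>At most one point off L and K, the meet of two fixed lines, can fail to have colour b;
    a fourth point on one of these lines rules it out as well.\<close>
  have through: "m \<le> jn k (inf (jn n k') L)"
    if m: "pt m" "m \<le> R" "\<not> m \<le> L" "\<not> m \<le> K" "d m \<noteq> b"
      and k: "pt k" "k \<le> K" "k \<noteq> s" "d k = b" and k': "pt k'" "k' \<le> K" "k' \<noteq> s" "d k' = b" "k \<noteq> k'"
    for m k k'
  proof -
    note N' = off_s[OF n(1,2,4) k'(1-3)]
    note M = off_s[OF m(1,2,4) k(1-3)]
    have "\<not> m \<le> jn n k'"
      using spread[OF N'(3,4,1) n(1) k'(1) N'(7,5,6) dn k'(4) m(1) _ m(3)] m(5) by blast
    then have ne: "jn m k \<noteq> jn n k'" using M by metis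
    \<comment> \<open>\<open>y\<close> lies on \<open>L\<close>: otherwise it has colour
      \<open>b\<close>, and together with \<open>k\<close> passes that colour to \<open>m\<close>.
      So \<open>y\<close> is the meet of \<open>jn n k'\<close> with \<open>L\<close>, which does
      not depend on \<open>m\<close>.\<close>
    define y where "y = inf (jn m k) (jn n k')"
    have y: "pt y" "y \<le> jn m k" "y \<le> jn n k'"
      using plane_meet[OF R M(3) N'(3) M(4) N'(4) ne] by (auto simp: y_def)
    have "\<not> k \<le> jn n k'"
      using pt_eq_of_lines[OF N'(3) K(1) N'(2) k(1) k'(1)] k k' N'(6) by metis
    then have yk: "k \<noteq> y" using y by metis
    have "y \<le> L"
    proof (rule ccontr)
      assume "\<not> y \<le> L"
      then have "d y = b" using spread[OF N'(3,4,1) n(1) k'(1) N'(7,5,6) dn k'(4) y(1,3)] by blast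
      then show False
        using spread[OF M(3,4,1) k(1) y(1) yk M(6) y(2) k(4) _ m(1) M(5) m(3)] m(5) by blast
    qed
    then have "y \<le> inf (jn n k') L" using y by simp
    then have "y = inf (jn n k') L" using pt_le_eq[OF y(1) meetL(1)[OF N'(3,4,1)]] by metis
    moreover have "jn k y = jn m k" using ln_eq_join[OF M(3) k(1) y(1) yk M(6) y(2)] .
    ultimately show ?thesis using M by simp
  qed
  have off: "d m = b" if m: "pt m" "m \<le> R" "\<not> m \<le> L" "\<not> m \<le> K" for m
  proof (rule ccontr)
    assume dm: "d m \<noteq> b"
    define h1 where "h1 = inf (jn n k1) L"
    define h2 where "h2 = inf (jn n k2) L"
    note N1 = off_s[OF n(1,2,4) k1(1-3)]
    note N2 = off_s[OF n(1,2,4) k2(1-3)]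
    have h1: "pt h1" "h1 \<le> L" "\<not> h1 \<le> K" using meetL[OF N1(3,4,1)] by (simp_all add: h1_def)
    have h2: "pt h2" "h2 \<le> L" "\<not> h2 \<le> K" using meetL[OF N2(3,4,1)] by (simp_all add: h2_def)
    \<comment> \<open>The indices cross: \<open>through\<close> places \<open>m\<close> on the line
      from \<open>k1\<close> to the point \<open>h2\<close> obtained from \<open>k2\<close>, and
      vice versa.\<close>
    define Q1 where "Q1 = jn k1 h2"
    define Q2 where "Q2 = jn k2 h1"
    have Q: "x \<le> Q1 \<and> x \<le> Q2" if "pt x" "x \<le> R" "\<not> x \<le> L" "\<not> x \<le> K" "d x \<noteq> b" for x
      using through[OF that k1(1-3) dk(1) k2(1-3) dk(2)] through[OF that k2(1-3) dk(2) k1(1-3) dk(1)] k2(5)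
      by (simp add: Q1_def Q2_def h1_def h2_def)
    have hR: "h1 \<le> R" "h2 \<le> R" using order.trans[OF _ L(2)] h1 h2 by blast+
    have kh: "k1 \<noteq> h2" "k2 \<noteq> h1" using k1 k2 h1 h2 by metis+
    have Q1: "ln Q1" "Q1 \<le> R" "k1 \<le> Q1" "h2 \<le> Q1"
      using line[OF k1(1) h2(1) kh(1) KR[OF k1(2)] hR(2)] by (simp_all add: Q1_def)
    have Q2: "ln Q2" "Q2 \<le> R" "k2 \<le> Q2" "h1 \<le> Q2"
      using line[OF k2(1) h1(1) kh(2) KR[OF k2(2)] hR(1)] by (simp_all add: Q2_def)
    have mQ: "m \<le> Q1" "m \<le> Q2" using Q[OF m dm] by auto
    have Q1K: "Q1 \<noteq> K" and Q1L: "Q1 \<noteq> L" using mQ m by metis+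
    then have sQ1: "\<not> s \<le> Q1"
      using pt_eq_of_lines[OF Q1(1) K(1) _ k1(1) s(1) Q1(3) _ k1(2) s(3)] k1(3) by metis
    have Q12: "Q1 \<noteq> Q2"
      using pt_eq_of_lines[OF Q1(1) K(1) Q1K k1(1) k2(1) Q1(3) _ k1(2) k2(2)] k2(5) Q2(3) by metis
    \<comment> \<open>\<open>Q1\<close> meets \<open>L\<close>, \<open>K\<close> and
      \<open>Q2\<close> only in \<open>h2\<close>, \<open>k1\<close> and \<open>m\<close>. Hence
      \<open>w\<close> is off all three and has colour \<open>b\<close>, which spreads from
      \<open>k1\<close> and \<open>w\<close> to \<open>m\<close>.\<close>
    obtain w where w: "pt w" "w \<le> Q1" "w \<noteq> m" "w \<noteq> k1" "w \<noteq> h2"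
      using richE[OF rich[OF Q1(1)]] by metis
    have wL: "\<not> w \<le> L" using pt_eq_of_lines[OF Q1(1) L(1) Q1L w(1) h2(1) w(2) Q1(4) _ h2(2)] w by metis
    have wK: "\<not> w \<le> K" using pt_eq_of_lines[OF Q1(1) K(1) Q1K w(1) k1(1) w(2) Q1(3) _ k1(2)] w by metis
    have wQ2: "\<not> w \<le> Q2"
      using pt_eq_of_lines[OF Q1(1) Q2(1) Q12 w(1) m(1) w(2) mQ(1) _ mQ(2)] w by metis
    have "d w = b" using Q[OF w(1) order.trans[OF w(2) Q1(2)] wL wK] wQ2 by metis
    then show False
      using spread[OF Q1(1,2) sQ1 k1(1) w(1) w(4)[symmetric] Q1(3) w(2) dk(1) _ m(1) mQ(1) m(3)] dm by blast
  qed
  have "d x = b" if x: "pt x" "x \<le> R" "\<not> x \<le> L" for x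
  proof (cases "x \<le> K")
    case True
    have xs: "x \<noteq> s" using x s by metis
    note N = off_s[OF n(1,2,4) x(1) True xs]
    note h = meetL[OF N(3,4,1)]
    have NL: "jn n x \<noteq> L" using N s by metis
    \<comment> \<open>\<open>x\<close> could still be the exception \<open>p\<close> of
      \<open>K\<close>. A fourth point \<open>w\<close> of the line from \<open>n\<close>, off
      \<open>L\<close> and \<open>K\<close>, has colour \<open>b\<close>, and \<open>n\<close> and
      \<open>w\<close> pass it to \<open>x\<close>.\<close>
    obtain w where w: "pt w" "w \<le> jn n x" "w \<noteq> n" "w \<noteq> x" "w \<noteq> inf (jn n x) L"
      using richE[OF rich[OF N(3)]] by metis
    have wL: "\<not> w \<le> L" using pt_eq_of_lines[OF N(3) L(1) NL w(1) h(1) w(2) h(2) _ h(3)] w by metis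
    have wK: "\<not> w \<le> K" using pt_eq_of_lines[OF N(3) K(1) N(2) w(1) x(1) w(2) N(6) _ True] w by metis
    have "d w = b" using off[OF w(1) order.trans[OF w(2) N(4)] wL wK] .
    then show ?thesis using spread[OF N(3,4,1) n(1) w(1) w(3)[symmetric] N(5) w(2) dn _ x(1) N(6) x(3)] by blast
  qed (use off x in auto)
  then show ?thesis by blast
qed

text \<open>If two lines have different majorities, \<open>plane_majority_aux\<close> leaves a
  single colour on all points off one of them; any other line meets that one in a point, its only
  possible exception.\<close>

lemma plane_majority:
  assumes R: "R \<in> FL" "rk R = 3" and tgt: "\<And>N. \<lbrakk>ln N; N \<le> R\<rbrakk> \<Longrightarrow> \<exists>e. maj d N e"
  obtains a K where "\<And>N. \<lbrakk>ln N; N \<le> R; N \<noteq> K\<rbrakk> \<Longrightarrow> maj d N a"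
proof (cases "\<exists>L K a b. ln L \<and> L \<le> R \<and> ln K \<and> K \<le> R \<and> maj d L a \<and> maj d K b \<and> a \<noteq> b")
  case False
  then show ?thesis using that tgt by metis
next
  case True
  then obtain L K a b where L: "ln L" "L \<le> R" "maj d L a" and K: "ln K" "K \<le> R" "maj d K b" and ab: "a \<noteq> b"
    by blast
  have LK: "L \<noteq> K" using maj_unique[OF L(1,3)] K(3) ab by metis
  have off: "maj d N e" if "\<And>x. \<lbrakk>pt x; x \<le> R; \<not> x \<le> X\<rbrakk> \<Longrightarrow> d x = e" "ln X" "X \<le> R" "ln N" "N \<le> R" "N \<noteq> X"
    for N X e
    unfolding maj_def
  proof (intro exI[of _ "inf N X"] allI impI)
    fix x assume x: "pt x" "x \<le> N" "x \<noteq> inf N X"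
    have "pt (inf N X)" using plane_meet[OF R that(4,2,5,3,6)] .
    then have "\<not> x \<le> X" using pt_le_eq[of x "inf N X"] x by auto
    then show "d x = e" using that(1)[OF x(1) order.trans[OF x(2) that(5)]] by metis
  qed
  have "pt (inf L K)" using plane_meet[OF R L(1) K(1) L(2) K(2) LK] .
  \<comment> \<open>The meet of \<open>L\<close> and \<open>K\<close> lacks one of the colours
    \<open>a\<close>, \<open>b\<close>, hence is the exception of the respective line.\<close>
  then consider (1) "\<And>x. \<lbrakk>pt x; x \<le> L; \<not> x \<le> K\<rbrakk> \<Longrightarrow> d x = a" | (2) "\<And>x. \<lbrakk>pt x; x \<le> K; \<not> x \<le> L\<rbrakk> \<Longrightarrow> d x = b"
    using maj_other[OF L(3), of "inf L K"] maj_other[OF K(3), of "inf L K"] ab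
    by (metis inf.cobounded1 inf.cobounded2)
  then have "(\<forall>x. pt x \<longrightarrow> x \<le> R \<longrightarrow> \<not> x \<le> L \<longrightarrow> d x = b) \<or> (\<forall>x. pt x \<longrightarrow> x \<le> R \<longrightarrow> \<not> x \<le> K \<longrightarrow> d x = a)"
  proof cases
    case 1
    then show ?thesis using plane_majority_aux[OF R tgt L(1,2) K(1,2) LK _ K(3) ab] by blast
  next
    case 2
    then show ?thesis
      using plane_majority_aux[OF R tgt K(1,2) L(1,2) LK[symmetric] _ L(3) ab[symmetric]] by blast
  qed
  then show ?thesis using off[OF _ L(1,2)] off[OF _ K(1,2)] that by metis
qed

subsection \<open>Monochromatic complements of hyperplanes\<close>

text \<open>Lines of \<open>R\<close> through \<open>x\<close> correspond to the points of a line
  \<open>l\<close> that misses \<open>x\<close>; excluding \<open>A\<close> and \<open>B\<close>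
  excludes at most their meets with \<open>l\<close>.\<close>

lemma third_line:
  assumes R: "R \<in> FL" "rk R = 3" and x: "pt x" "x \<le> R"
  obtains N where "ln N" "N \<le> R" "x \<le> N" "N \<noteq> A" "N \<noteq> B"
proof -
  obtain l where l: "l \<in> FL" "l \<le> R" "\<not> x \<le> l" "rk R = Suc (rk l)" using hyperplane_avoiding[OF R(1) x] .
  then have ll: "ln l" using R unfolding ln_def by simp
  obtain w where w: "pt w" "w \<le> l" "w \<noteq> inf A l" "w \<noteq> inf B l" using richE[OF rich[OF ll]] by metis
  have xw: "x \<noteq> w" using w l by metis
  have "w \<le> R" using order.trans[OF w(2) l(2)] .
  then have N: "ln (jn x w)" "jn x w \<le> R" "x \<le> jn x w" "w \<le> jn x w"
    using ln_join[OF x(1) w(1) xw] x w R by simp_all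
  have "jn x w \<noteq> l" using N l by metis
  then have "pt (inf (jn x w) l)" using plane_meet[OF R N(1) ll N(2) l(2)] by metis
  moreover have "w \<le> inf (jn x w) l" using w N by simp
  ultimately have "w = inf (jn x w) l" using pt_le_eq[OF w(1)] by metis
  then show ?thesis using that[OF N(1-3)] w by metis
qed

lemma rank2_hyperplane:
  assumes F: "F \<in> FL" "rk F = 2" and tgt: "\<And>L. \<lbrakk>ln L; L \<le> F\<rbrakk> \<Longrightarrow> \<exists>a. maj d L a"
  shows "\<exists>H a. H \<in> FL \<and> H \<le> F \<and> rk F = Suc (rk H) \<and> (\<forall>x. pt x \<longrightarrow> x \<le> F \<longrightarrow> \<not> x \<le> H \<longrightarrow> d x = a)"
proof -
  have "ln F" using F unfolding ln_def by simp
  then obtain a where "maj d F a" using tgt[of F] by auto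
  then obtain p where p: "\<And>x. \<lbrakk>pt x; x \<le> F; x \<noteq> p\<rbrakk> \<Longrightarrow> d x = a" unfolding maj_def by metis
  obtain q where q: "pt q" "q \<le> F" using richE[OF rich[OF \<open>ln F\<close>]] by metis
  \<comment> \<open>An exception that is not a point of \<open>F\<close> is replaced by an arbitrary
    point \<open>q\<close>, as \<open>H\<close> must have rank 1.\<close>
  define H where "H = (if pt p \<and> p \<le> F then p else q)"
  have H: "pt H" "H \<le> F" using q by (auto simp: H_def)
  have "d x = a" if "pt x" "x \<le> F" "\<not> x \<le> H" for x
    using p[OF that(1,2)] that by (metis H_def order.refl)
  then show ?thesis using H F pt_FL[OF H(1)] pt_rk[OF H(1)] by (metis One_nat_def Suc_1)
qed

theorem hyperplane_monochromatic:
  assumes "F \<in> FL" "0 < rk F" "\<And>L. \<lbrakk>ln L; L \<le> F\<rbrakk> \<Longrightarrow> \<exists>a. maj d L a"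
  shows "\<exists>H a. H \<in> FL \<and> H \<le> F \<and> rk F = Suc (rk H) \<and> (\<forall>x. pt x \<longrightarrow> x \<le> F \<longrightarrow> \<not> x \<le> H \<longrightarrow> d x = a)"
  using assms
\<comment> \<open>\<open>d\<close> is generalised because the induction hypothesis is applied to a
  colouring \<open>e\<close> of a hyperplane by majority colours.\<close>
proof (induction "rk F" arbitrary: F d rule: less_induct)
  case less
  note F = less.prems(1) and tgt = less.prems(3)
  consider "rk F = 1" | "rk F = 2" | "3 \<le> rk F" using less.prems(2) by linarith
  then show ?case
  proof cases
    case 1
    then have ptF: "pt F" using F unfolding pt_def by simp
    obtain H where "H \<in> FL" "H \<le> F" "rk F = Suc (rk H)" using hyperplane_avoiding[OF F ptF order.refl] .
    then show ?thesis using pt_le_eq ptF by metis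
  next
    case 2
    then show ?thesis using rank2_hyperplane[OF F] tgt by blast
  next
    case 3
    have star: "\<exists>K a. K \<in> FL \<and> x \<le> K \<and> K \<le> F \<and> rk F = Suc (rk K) \<and>
        (\<forall>N. ln N \<longrightarrow> N \<le> F \<longrightarrow> x \<le> N \<longrightarrow> \<not> N \<le> K \<longrightarrow> maj d N a)" if x: "pt x" "x \<le> F" for x
    proof -
      obtain H where H: "H \<in> FL" "H \<le> F" "\<not> x \<le> H" "rk F = Suc (rk H)" using hyperplane_avoiding[OF F x] .
      \<comment> \<open>For \<open>y\<close> on \<open>H\<close> the line \<open>jn x y\<close> is a
        target line below \<open>F\<close>, so \<open>THE\<close> picks its unique majority.\<close>
      define e where "e = (\<lambda>y. THE a. maj d (jn x y) a)"
      have xy: "ln (jn x y)" "x \<le> jn x y" "y \<le> jn x y" "jn x y \<le> F" "x \<noteq> y" if "pt y" "y \<le> H" for y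
      proof -
        show "x \<noteq> y" using that H by metis
        then show "ln (jn x y)" using ln_join x that by metis
        show "x \<le> jn x y" "y \<le> jn x y" using x that by simp_all
        show "jn x y \<le> F" using x that order.trans[OF that(2) H(2)] F by simp
      qed
      have e: "e y = a" if "pt y" "y \<le> H" "maj d (jn x y) a" for y a
        unfolding e_def using that maj_unique[OF xy(1)[OF that(1,2)]] by (metis the_equality)
      have eH: "\<exists>a. maj e l a" if l: "ln l" "l \<le> H" for l
      proof -
        define R where "R = jn x l"
        have xl: "\<not> x \<le> l" using l H(3) order.trans by metis
        have R: "R \<in> FL" "rk R = 3" "l \<le> R" "x \<le> R" "R \<le> F"
          using x xl l pt_join[of x l] F order.trans[OF l(2) H(2)] by (simp_all add: R_def)
        obtain a K where K: "\<And>N. \<lbrakk>ln N; N \<le> R; N \<noteq> K\<rbrakk> \<Longrightarrow> maj d N a"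
          using plane_majority[OF R(1,2), of d] tgt order.trans[OF _ R(5)] by metis
        \<comment> \<open>Among the lines joining \<open>x\<close> to points \<open>y\<close> of
          \<open>l\<close> only \<open>K\<close> can deviate; if \<open>K\<close> is
          \<open>jn x y\<close>, then \<open>y\<close> is \<open>inf K l\<close>.\<close>
        have "e y = a" if y: "pt y" "y \<le> l" "y \<noteq> inf K l" for y
        proof -
          have yH: "y \<le> H" using order.trans[OF y(2) l(2)] .
          have "y \<le> R" using order.trans[OF y(2) R(3)] .
          then have yR: "jn x y \<le> R" using x y R by simp
          have "jn x y \<noteq> l" using xy(2)[OF y(1) yH] xl by metis
          then have "pt (inf (jn x y) l)" using plane_meet[OF R(1,2) xy(1)[OF y(1) yH] l(1) yR R(3)] by metis
          moreover have "y \<le> inf (jn x y) l" using xy(3)[OF y(1) yH] y by simp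
          ultimately have "y = inf (jn x y) l" using pt_le_eq[OF y(1)] by metis
          then have "jn x y \<noteq> K" using y(3) by metis
          then show ?thesis using e[OF y(1) yH] K[OF xy(1)[OF y(1) yH] yR] by metis
        qed
        then show ?thesis unfolding maj_def by blast
      qed
      have "rk H < rk F" "0 < rk H" using H(4) 3 by simp_all
      then obtain G a where G: "G \<in> FL" "G \<le> H" "rk H = Suc (rk G)"
        and a: "\<And>y. \<lbrakk>pt y; y \<le> H; \<not> y \<le> G\<rbrakk> \<Longrightarrow> e y = a"
        using less.hyps[of H e] H(1) eH by blast
      have xG: "\<not> x \<le> G" using order.trans[OF _ G(2)] H(3) by metis
      have GF: "G \<le> F" using order.trans[OF G(2) H(2)] .
      \<comment> \<open>The cone over \<open>G\<close> with apex \<open>x\<close> is a hyperplane of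
        \<open>F\<close>. A line through \<open>x\<close> outside it meets \<open>H\<close> in a
        point \<open>y\<close> off \<open>G\<close>, where \<open>e\<close> takes the value
        \<open>a\<close>.\<close>
      define K where "K = jn x G"
      have K: "K \<in> FL" "x \<le> K" "K \<le> F" "rk F = Suc (rk K)" "G \<le> K"
        using x G xG GF F H pt_join[OF x(1) G(1) xG] by (simp_all add: K_def)
      have "maj d N a" if N: "ln N" "N \<le> F" "x \<le> N" "\<not> N \<le> K" for N
      proof -
        define y where "y = inf N H"
        have "\<not> N \<le> H" using N H(3) order.trans by metis
        then have y: "pt y" "y \<le> N" "y \<le> H"
          using ln_meet_hyperplane[OF N(1) H(1) F N(2) H(2) H(4)] by (simp_all add: y_def)
        note xy = xy[OF y(1,3)]
        have Ny: "N = jn x y" using ln_eq_join[OF N(1) x(1) y(1) xy(5) N(3) y(2)] by simp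
        have "\<not> y \<le> G"
        proof
          assume "y \<le> G"
          then have "y \<le> K" using order.trans K(5) by metis
          then show False using N(4) Ny K(1,2) x(1) y(1) by simp
        qed
        then have "e y = a" using a y by metis
        moreover obtain b where b: "maj d (jn x y) b" using tgt[OF xy(1,4)] by metis
        ultimately show ?thesis using e[OF y(1,3) b] Ny by metis
      qed
      then show ?thesis using K by blast
    qed
    have same: "a = b"
      if x: "pt x" "x \<le> F" and K: "K \<in> FL" "x \<le> K" "K \<le> F" "rk F = Suc (rk K)"
          "\<And>N. \<lbrakk>ln N; N \<le> F; x \<le> N; \<not> N \<le> K\<rbrakk> \<Longrightarrow> maj d N a"
        and y: "pt y" "y \<le> F" and H: "H \<in> FL" "y \<le> H" "H \<le> F" "rk F = Suc (rk H)"
          "\<And>N. \<lbrakk>ln N; N \<le> F; y \<le> N; \<not> N \<le> H\<rbrakk> \<Longrightarrow> maj d N b"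
      for x K a y H b
    proof -
      \<comment> \<open>As \<open>z\<close> avoids both hyperplanes, neither contains a line or
        plane through \<open>z\<close>. If \<open>x\<close>, \<open>y\<close>, \<open>z\<close> are
        on one line, that line has majorities \<open>a\<close> and \<open>b\<close>; otherwise the
        plane \<open>R\<close> on them mediates.\<close>
      obtain z where z: "pt z" "z \<le> F" "\<not> z \<le> K" "\<not> z \<le> H"
        using hyperplanes_not_cover[OF F K(1,3,4) H(1,3,4)] .
      have zx: "z \<noteq> x" "z \<noteq> y" using z K H by metis+
      have direct: "a = b" if N: "ln N" "N \<le> F" "x \<le> N" "y \<le> N" "z \<le> N" for N
      proof -
        have "\<not> N \<le> K" "\<not> N \<le> H" using z N(5) order.trans by metis+
        then show ?thesis using maj_unique[OF N(1)] K(5)[OF N(1-3)] H(5)[OF N(1,2,4)] by metis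
      qed
      define X where "X = jn z x"
      have X: "ln X" "X \<le> F" "x \<le> X" "z \<le> X"
        using ln_join[OF z(1) x(1) zx(1)] x z F by (simp_all add: X_def)
      show ?thesis
      proof (cases "y \<le> X")
        case True
        then show ?thesis using direct X by metis
      next
        case False
        define R where "R = jn y X"
        have R: "R \<in> FL" "rk R = 3" "R \<le> F" "X \<le> R" "y \<le> R"
          using pt_join[OF y(1) _ False] X y F by (simp_all add: R_def)
        have R': "x \<le> R" "z \<le> R" using order.trans[OF _ R(4)] X by metis+
        obtain c C where C: "\<And>N. \<lbrakk>ln N; N \<le> R; N \<noteq> C\<rbrakk> \<Longrightarrow> maj d N c"
          using plane_majority[OF R(1,2), of d] tgt order.trans[OF _ R(3)] by metis
        \<comment> \<open>Through \<open>w\<close> runs a line of \<open>R\<close> that is neither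
          the deviating \<open>C\<close> nor the trace \<open>inf R G\<close>; it has both
          majorities \<open>a'\<close> and \<open>c\<close>.\<close>
        have colour: "a' = c"
          if w: "pt w" "w \<le> R" and G: "G \<in> FL" "G \<le> F" "\<not> z \<le> G" "rk F = Suc (rk G)"
            and maj: "\<And>N. \<lbrakk>ln N; N \<le> F; w \<le> N; \<not> N \<le> G\<rbrakk> \<Longrightarrow> maj d N a'" for w G a'
        proof -
          have RG: "\<not> R \<le> G" using R' G(3) order.trans by metis
          then have rG: "rk (inf R G) = 2" using meet_hyperplane[OF R(1) G(1) F R(3) G(2,4)] R by simp
          obtain N where N: "ln N" "N \<le> R" "w \<le> N" "N \<noteq> C" "N \<noteq> inf R G"
            using third_line[OF R(1,2) w] .
          have "\<not> N \<le> G"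
          proof
            assume "N \<le> G"
            then have "N \<le> inf R G" using N by simp
            then have "N = inf R G" using N rG R G by (intro flat_eqI) simp_all
            then show False using N by metis
          qed
          then have "maj d N a'" using maj[OF N(1) order.trans[OF N(2) R(3)] N(3)] by metis
          then show ?thesis using maj_unique[OF N(1)] C[OF N(1,2,4)] by metis
        qed
        have "a = c"
          by (rule colour[OF x(1) R'(1) K(1,3) z(3) K(4)]) (rule K(5))
        moreover have "b = c"
          by (rule colour[OF y(1) R(5) H(1,3) z(4) H(4)]) (rule H(5))
        ultimately show ?thesis by simp
      qed
    qed
    have Fne: "\<exists>x. pt x \<and> x \<le> F"
    proof -
      obtain Z where Z: "Z \<in> FL" "rk Z = 0" using bottom by auto
      then have "\<not> F \<le> Z" using rk_not_le[OF F, of Z] 3 by simp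
      then show ?thesis using obtain_pt[OF Z(1) F] by metis
    qed
    then obtain o' where o': "pt o'" "o' \<le> F" by metis
    obtain K0 a where K0: "K0 \<in> FL" "o' \<le> K0" "K0 \<le> F" "rk F = Suc (rk K0)"
      "\<And>N. \<lbrakk>ln N; N \<le> F; o' \<le> N; \<not> N \<le> K0\<rbrakk> \<Longrightarrow> maj d N a" using star[OF o'] by metis
    show ?thesis
    proof (cases "\<forall>x. pt x \<longrightarrow> x \<le> F \<longrightarrow> d x = a")
      case True
      then show ?thesis using K0 by metis
    next
      case False
      then obtain x where x: "pt x" "x \<le> F" "d x \<noteq> a" by metis
      obtain K b where K: "K \<in> FL" "x \<le> K" "K \<le> F" "rk F = Suc (rk K)"
        "\<And>N. \<lbrakk>ln N; N \<le> F; x \<le> N; \<not> N \<le> K\<rbrakk> \<Longrightarrow> maj d N b" using star[OF x(1,2)] by metis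
      have ab: "a = b"
        by (rule same[OF o' K0(1-4) _ x(1,2) K(1-4)]) (rule K0(5) K(5); assumption)+
      have "d y = a" if y: "pt y" "y \<le> F" "\<not> y \<le> K" for y
      proof -
        have xy: "x \<noteq> y" using y K by metis
        have N: "ln (jn x y)" "jn x y \<le> F" "x \<le> jn x y" "y \<le> jn x y"
          using ln_join[OF x(1) y(1) xy] x y F by simp_all
        have "\<not> jn x y \<le> K" using N(4) y(3) order.trans by metis
        then have "maj d (jn x y) a" using K(5)[OF N(1-3)] ab by metis
        then show ?thesis using maj_other[OF _ x(1) y(1) N(3,4) xy, of d a] x(3) by metis
      qed
      then show ?thesis using K by metis
    qed
  qed
qed

end

section \<open>Closure and flats of matroids\<close>

lemma matroid_indep_subset: "\<lbrakk>matroid M; J \<in> indeps M; I \<subseteq> J\<rbrakk> \<Longrightarrow> I \<in> indeps M"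
  unfolding matroid_def by blast

lemma matroid_augment:
  "\<lbrakk>matroid M; I \<in> indeps M; J \<in> indeps M; card I < card J\<rbrakk> \<Longrightarrow> \<exists>e\<in>J - I. insert e I \<in> indeps M"
  unfolding matroid_def by blast

lemma matroid_indep_finite: "\<lbrakk>matroid M; I \<in> indeps M\<rbrakk> \<Longrightarrow> finite I"
  unfolding matroid_def by (meson PowD finite_subset subsetD)

lemma matroid_indep_ground: "\<lbrakk>matroid M; I \<in> indeps M\<rbrakk> \<Longrightarrow> I \<subseteq> ground M"
  unfolding matroid_def by blast

lemma matroid_finite_indeps:
  assumes "matroid M" shows "finite {I \<in> indeps M. I \<subseteq> X}"
proof (rule finite_subset)
  show "{I \<in> indeps M. I \<subseteq> X} \<subseteq> Pow (ground M)" using assms matroid_indep_ground by auto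
  show "finite (Pow (ground M))" using assms unfolding matroid_def by simp
qed

lemma indep_card_le_rank:
  assumes "matroid M" "I \<in> indeps M" "I \<subseteq> X" shows "card I \<le> matroid_rank M X"
  unfolding matroid_rank_def using assms matroid_finite_indeps by (intro Max_ge) auto

lemma obtain_basis:
  assumes "matroid M"
  obtains B where "B \<in> indeps M" "B \<subseteq> X" "card B = matroid_rank M X"
proof -
  have "{} \<in> indeps M" using assms by (simp add: matroid_def)
  then have "matroid_rank M X \<in> card ` {I \<in> indeps M. I \<subseteq> X}"
    unfolding matroid_rank_def using assms matroid_finite_indeps by (intro Max_in) auto
  then show ?thesis using that by auto
qed

lemma matroid_rank_mono:
  assumes "matroid M" "X \<subseteq> Y" shows "matroid_rank M X \<le> matroid_rank M Y"
proof -
  obtain B where "B \<in> indeps M" "B \<subseteq> X" "card B = matroid_rank M X" using obtain_basis assms by blast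
  then show ?thesis using indep_card_le_rank[of M B Y] assms by auto
qed

lemma matroid_rank_indep: "\<lbrakk>matroid M; I \<in> indeps M\<rbrakk> \<Longrightarrow> matroid_rank M I = card I"
proof -
  assume M: "matroid M" and I: "I \<in> indeps M"
  obtain B where "B \<subseteq> I" "card B = matroid_rank M I" using obtain_basis M by blast
  then show ?thesis using indep_card_le_rank[OF M I, of I] card_mono[of I B] matroid_indep_finite[OF M I] by auto
qed

lemma indep_augment_from:
  assumes M: "matroid M" and I: "I \<in> indeps M" and lt: "card I < matroid_rank M Y"
  obtains e where "e \<in> Y - I" "insert e I \<in> indeps M"
proof -
  obtain B where B: "B \<in> indeps M" "B \<subseteq> Y" "card B = matroid_rank M Y" using obtain_basis M by blast
  show ?thesis using matroid_augment[OF M I B(1)] B lt that by auto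
qed

lemma extend_to_basis:
  assumes M: "matroid M" and I: "I \<in> indeps M" "I \<subseteq> Y"
  obtains B where "B \<in> indeps M" "I \<subseteq> B" "B \<subseteq> Y" "card B = matroid_rank M Y"
proof -
  let ?P = "\<lambda>B. B \<in> indeps M \<and> I \<subseteq> B \<and> B \<subseteq> Y"
  have "\<exists>B. ?P B \<and> (\<forall>B'. ?P B' \<longrightarrow> card B' \<le> card B)"
    using I indep_card_le_rank[OF M, of _ Y]
    by (intro ex_has_greatest_nat[of ?P I card "Suc (matroid_rank M Y)"]) (auto intro: le_imp_less_Suc)
  then obtain B where B: "B \<in> indeps M" "I \<subseteq> B" "B \<subseteq> Y"
    and max: "\<And>B'. ?P B' \<Longrightarrow> card B' \<le> card B"
    by (elim exE conjE) blast
  have "\<not> card B < matroid_rank M Y"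
  proof
    assume "card B < matroid_rank M Y"
    then obtain e where "e \<in> Y - B" "insert e B \<in> indeps M" using indep_augment_from M B by blast
    then show False using max[of "insert e B"] B matroid_indep_finite[OF M, of B] by auto
  qed
  then show ?thesis using that[of B] B indep_card_le_rank[OF M, of B Y] by auto
qed

lemma matroid_rank_le_card:
  assumes "matroid M" "finite X" shows "matroid_rank M X \<le> card X"
  by (metis assms card_mono obtain_basis)

lemma in_clD: "e \<in> matroid_cl M X \<Longrightarrow> e \<in> ground M \<and> matroid_rank M (insert e X) = matroid_rank M X"
  by (simp add: matroid_cl_def)

lemma cl_ground: "matroid_cl M X \<subseteq> ground M"
  by (auto simp: matroid_cl_def)

text \<open>If \<open>Y\<close> raised the rank, a basis of \<open>X\<close> could be enlarged by
  some \<open>e\<close> in \<open>X \<union> Y\<close>; but \<open>insert e X\<close> has only the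
  rank of \<open>X\<close>.\<close>

lemma rank_Un_cl:
  assumes M: "matroid M" and Y: "Y \<subseteq> matroid_cl M X"
  shows "matroid_rank M (X \<union> Y) = matroid_rank M X"
proof (rule antisym[OF leI])
  obtain B where B: "B \<in> indeps M" "B \<subseteq> X" "card B = matroid_rank M X" using obtain_basis M by blast
  show "\<not> matroid_rank M X < matroid_rank M (X \<union> Y)"
  proof
    assume "matroid_rank M X < matroid_rank M (X \<union> Y)"
    then obtain e where e: "e \<in> X \<union> Y - B" "insert e B \<in> indeps M"
      using indep_augment_from M B by metis
    have "card (insert e B) \<le> matroid_rank M (insert e X)"
      using e B M by (intro indep_card_le_rank) auto
    moreover have "matroid_rank M (insert e X) = matroid_rank M X"
      using e Y by (auto simp: matroid_cl_def insert_absorb)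
    ultimately show False using e B matroid_indep_finite[OF M B(1)] by simp
  qed
qed (use M in \<open>simp add: matroid_rank_mono\<close>)

lemma subset_cl: "X \<subseteq> ground M \<Longrightarrow> X \<subseteq> matroid_cl M X"
  by (auto simp: matroid_cl_def insert_absorb)

lemma rank_cl: "\<lbrakk>matroid M; X \<subseteq> ground M\<rbrakk> \<Longrightarrow> matroid_rank M (matroid_cl M X) = matroid_rank M X"
  using rank_Un_cl[of M "matroid_cl M X" X] subset_cl[of X M] by (simp add: Un_absorb1)

text \<open>Extend a basis \<open>B\<close> of \<open>X\<close> to a basis \<open>C\<close> of
  \<open>Y\<close>. If \<open>e\<close> raised the rank of \<open>Y\<close>, it could be added to
  \<open>C\<close>, hence to \<open>B\<close>, and would not be in the closure of
  \<open>X\<close>.\<close>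

lemma cl_mono:
  assumes M: "matroid M" and XY: "X \<subseteq> Y" shows "matroid_cl M X \<subseteq> matroid_cl M Y"
proof
  fix e assume e: "e \<in> matroid_cl M X"
  obtain B where B: "B \<in> indeps M" "B \<subseteq> X" "card B = matroid_rank M X" using obtain_basis M by blast
  obtain C where C: "C \<in> indeps M" "B \<subseteq> C" "C \<subseteq> Y" "card C = matroid_rank M Y"
    using extend_to_basis[OF M B(1), of Y] B XY by blast
  have "\<not> matroid_rank M Y < matroid_rank M (insert e Y)"
  proof
    assume "matroid_rank M Y < matroid_rank M (insert e Y)"
    then obtain f where f: "f \<in> insert e Y - C" "insert f C \<in> indeps M"
      using indep_augment_from M C by metis
    have fin: "finite C" "finite B" using matroid_indep_finite M B C by auto
    have "f \<notin> Y" using indep_card_le_rank[OF M f(2), of Y] f C fin by auto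
    then have "f = e" using f by auto
    then have "insert e B \<in> indeps M" using matroid_indep_subset[OF M f(2), of "insert e B"] C by auto
    then have "card (insert e B) \<le> matroid_rank M (insert e X)"
      using B M by (intro indep_card_le_rank) auto
    then show False using in_clD[OF e] fin B C f \<open>f = e\<close> by (auto simp: card_insert_if split: if_splits)
  qed
  then show "e \<in> matroid_cl M Y"
    using in_clD[OF e] matroid_rank_mono[OF M subset_insertI[of Y e]] by (simp add: matroid_cl_def)
qed

lemma flat_cl:
  assumes M: "matroid M" and X: "X \<subseteq> ground M" shows "matroid_flat M (matroid_cl M X)"
proof -
  have "matroid_cl M (matroid_cl M X) \<subseteq> matroid_cl M X"
  proof
    fix e assume e: "e \<in> matroid_cl M (matroid_cl M X)"
    have "matroid_rank M (insert e X) \<le> matroid_rank M (insert e (matroid_cl M X))"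
      using M subset_cl[OF X] by (intro matroid_rank_mono) auto
    moreover have "matroid_rank M X \<le> matroid_rank M (insert e X)"
      using M by (intro matroid_rank_mono) auto
    ultimately show "e \<in> matroid_cl M X"
      using in_clD[OF e] rank_cl[OF M X] by (simp add: matroid_cl_def)
  qed
  then show ?thesis
    using cl_ground[of M X] subset_cl[OF cl_ground[of M X]] by (auto simp: matroid_flat_def)
qed

lemma cl_least: "\<lbrakk>matroid M; matroid_flat M F; X \<subseteq> F\<rbrakk> \<Longrightarrow> matroid_cl M X \<subseteq> F"
  using cl_mono[of M X F] by (auto simp: matroid_flat_def)

lemma flat_Int:
  assumes M: "matroid M" and F: "matroid_flat M F" "matroid_flat M G" shows "matroid_flat M (F \<inter> G)"
proof -
  have G: "F \<inter> G \<subseteq> ground M" using F by (auto simp: matroid_flat_def)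
  moreover have "matroid_cl M (F \<inter> G) \<subseteq> F \<inter> G"
    using cl_least[OF M F(1), of "F \<inter> G"] cl_least[OF M F(2), of "F \<inter> G"] by simp
  ultimately show ?thesis unfolding matroid_flat_def using subset_cl[OF G] by blast
qed

lemma flat_rank_strict:
  assumes M: "matroid M" and F: "matroid_flat M F" "matroid_flat M G" "F \<subset> G"
  shows "matroid_rank M F < matroid_rank M G"
proof -
  obtain e where e: "e \<in> G" "e \<notin> F" using F by auto
  then have "matroid_rank M (insert e F) \<noteq> matroid_rank M F"
    using F by (auto simp: matroid_flat_def matroid_cl_def)
  then show ?thesis
    using matroid_rank_mono[OF M subset_insertI[of F e]] matroid_rank_mono[OF M, of "insert e F" G] e F
    by (simp add: psubset_eq)
qed

lemma matroid_rank_empty: "matroid M \<Longrightarrow> matroid_rank M {} = 0"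
  using matroid_rank_le_card[of M "{}"] by simp

lemma cl_singleton_point:
  assumes M: "matroid M" and e: "e \<in> ground M" "e \<notin> matroid_cl M {}"
  shows "matroid_point M (matroid_cl M {e})"
proof -
  have "matroid_rank M {e} = 1"
    using matroid_rank_le_card[OF M, of "{e}"] matroid_rank_empty[OF M] e
    by (auto simp: matroid_cl_def)
  then show ?thesis using flat_cl[OF M, of "{e}"] rank_cl[OF M, of "{e}"] e
    by (auto simp: matroid_point_def)
qed

section \<open>The lattice of flats of a connected modular matroid\<close>

abbreviation flat_join :: "'a matroid_struct \<Rightarrow> 'a set \<Rightarrow> 'a set \<Rightarrow> 'a set" where
  "flat_join M A B \<equiv> matroid_cl M (A \<union> B)"

lemma modular_flats_of_matroid:
  assumes M: "matroid M" and mod: "matroid_modular M"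
  shows "modular_flats {F. matroid_flat M F} (flat_join M) (matroid_rank M)"
proof
  fix A B assume "A \<in> {F. matroid_flat M F}" "B \<in> {F. matroid_flat M F}"
  then have A: "matroid_flat M A" and B: "matroid_flat M B"
    and AB: "A \<subseteq> ground M" "B \<subseteq> ground M" "A \<union> B \<subseteq> ground M"
    by (auto simp: matroid_flat_def)
  show "A \<inter> B \<in> {F. matroid_flat M F}" using flat_Int[OF M A B] by simp
  show "flat_join M A B \<in> {F. matroid_flat M F}" using flat_cl[OF M AB(3)] by simp
  show "matroid_rank M A + matroid_rank M B = matroid_rank M (flat_join M A B) + matroid_rank M (A \<inter> B)"
    using mod A B rank_cl[OF M AB(3)] by (simp add: matroid_modular_def)
  show "matroid_rank M A < matroid_rank M B" if "A \<subset> B" using flat_rank_strict[OF M A B that] .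
  show "flat_join M A B \<subseteq> C \<longleftrightarrow> A \<subseteq> C \<and> B \<subseteq> C" if "C \<in> {F. matroid_flat M F}" for C
    using subset_cl[OF AB(3)] cl_least[OF M, of C "A \<union> B"] that by auto
  \<comment> \<open>Any \<open>e\<close> in \<open>B - A\<close> spans a point: loops lie in every
    flat, in particular in \<open>A\<close>.\<close>
  show "\<exists>x\<in>{F. matroid_flat M F}. matroid_rank M x = 1 \<and> x \<subseteq> B \<and> \<not> x \<subseteq> A" if "\<not> B \<subseteq> A"
  proof -
    obtain e where e: "e \<in> B" "e \<notin> A" using \<open>\<not> B \<subseteq> A\<close> by auto
    have "e \<notin> matroid_cl M {}" using cl_least[OF M A, of "{}"] e by auto
    then have "matroid_point M (matroid_cl M {e})" using cl_singleton_point[OF M, of e] e AB by auto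
    moreover have "matroid_cl M {e} \<subseteq> B" using cl_least[OF M B, of "{e}"] e by simp
    moreover have "e \<in> matroid_cl M {e}" using subset_cl[of "{e}" M] e AB by auto
    ultimately show ?thesis using e by (auto simp: matroid_point_def)
  qed
next
  show "\<exists>Z\<in>{F. matroid_flat M F}. matroid_rank M Z = 0"
    using flat_cl[OF M, of "{}"] rank_cl[OF M, of "{}"] matroid_rank_empty[OF M] by auto
qed

section \<open>Circuits and third points on lines\<close>

lemma circuit_rank:
  assumes M: "matroid M" and C: "matroid_circuit M C" and e: "e \<in> C"
  shows "Suc (matroid_rank M C) = card C" "matroid_rank M (C - {e}) = matroid_rank M C"
proof -
  have fin: "finite C" using C M unfolding matroid_circuit_def matroid_def by (meson finite_subset)
  have "C - {e} \<subset> C" using e by auto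
  then have ind: "C - {e} \<in> indeps M" using C unfolding matroid_circuit_def by blast
  have *: "Suc (matroid_rank M (C - {e})) = card C"
    unfolding matroid_rank_indep[OF M ind] using fin e by (rule card_Suc_Diff1)
  have "matroid_rank M C \<noteq> card C"
  proof
    assume rc: "matroid_rank M C = card C"
    obtain B where "B \<in> indeps M" "B \<subseteq> C" "card B = matroid_rank M C" using obtain_basis[OF M] .
    then show False using C card_subset_eq[OF fin, of B] rc by (auto simp: matroid_circuit_def)
  qed
  then show "matroid_rank M (C - {e}) = matroid_rank M C" "Suc (matroid_rank M C) = card C"
    using * matroid_rank_le_card[OF M fin] matroid_rank_mono[OF M, of "C - {e}" C] by auto
qed

lemma point_eq_cl:
  assumes M: "matroid M" and p: "matroid_point M p"
  obtains e where "e \<in> p" "p = matroid_cl M {e}" "matroid_rank M {e} = 1"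
proof -
  obtain B where B: "B \<in> indeps M" "B \<subseteq> p" "card B = 1"
    using obtain_basis[OF M, of p] p by (metis matroid_point_def)
  then obtain e where e: "B = {e}" by (meson card_1_singletonE)
  have r: "matroid_rank M {e} = 1" using matroid_rank_indep[OF M B(1)] B e by simp
  have ep: "e \<in> p" and eg: "e \<in> ground M" using B e p by (auto simp: matroid_point_def matroid_flat_def)
  have "matroid_cl M {e} \<subseteq> p" using cl_least[OF M _, of p "{e}"] p ep by (simp add: matroid_point_def)
  moreover have "\<not> matroid_cl M {e} \<subset> p"
  proof
    assume "matroid_cl M {e} \<subset> p"
    then have "matroid_rank M (matroid_cl M {e}) < matroid_rank M p"
      using flat_rank_strict[OF M flat_cl[OF M, of "{e}"], of p] p eg by (simp add: matroid_point_def)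
    then show False using rank_cl[OF M, of "{e}"] r eg p by (simp add: matroid_point_def)
  qed
  ultimately show ?thesis using that[OF ep _ r] by blast
qed

text \<open>The third point is the meet of the line spanned by e and f with the closure of C - {e, f},
  where C is a circuit through e and f.\<close>

lemma connected_third_point:
  assumes M: "matroid M" and con: "matroid_connected M" and mod: "matroid_modular M"
    and p: "matroid_point M p" and q: "matroid_point M q" and pq: "p \<noteq> q"
  shows "\<exists>z. matroid_point M z \<and> z \<subseteq> flat_join M p q \<and> z \<noteq> p \<and> z \<noteq> q"
proof -
  interpret modular_flats "{F. matroid_flat M F}" "flat_join M" "matroid_rank M"
    by (rule modular_flats_of_matroid[OF M mod])
  have pt_iff: "pt x \<longleftrightarrow> matroid_point M x" for x by (simp add: pt_def matroid_point_def)
  obtain e where e: "e \<in> p" "p = matroid_cl M {e}" using point_eq_cl[OF M p] .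
  obtain f where f: "f \<in> q" "q = matroid_cl M {f}" using point_eq_cl[OF M q] .
  have ef: "e \<noteq> f" using e f pq by auto
  have g: "e \<in> ground M" "f \<in> ground M" using e f cl_ground[of M] by blast+
  obtain C where C: "matroid_circuit M C" "e \<in> C" "f \<in> C" using con ef g unfolding matroid_connected_def by blast
  have Cg: "C \<subseteq> ground M" using C by (simp add: matroid_circuit_def)
  have fin: "finite C" using Cg M unfolding matroid_def by (meson finite_subset)
  let ?D0 = "C - {e, f}"
  define D where "D = matroid_cl M ?D0"
  define L where "L = flat_join M p q"
  have D: "matroid_flat M D" using flat_cl[OF M, of ?D0] Cg by (auto simp: D_def)
  have D0D: "?D0 \<subseteq> D" using subset_cl[of ?D0 M] Cg by (auto simp: D_def)
  have Lln: "ln L" using ln_join[of p q] p q pq by (simp add: pt_iff L_def)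
  then have L: "matroid_flat M L" "matroid_rank M L = 2" by (auto simp: ln_def)
  have pL: "p \<subseteq> L" "q \<subseteq> L" using le_jn[of p q] p q by (auto simp: L_def matroid_point_def)
  have rD: "matroid_rank M D = card C - 2"
  proof -
    have "?D0 \<subset> C" using C by auto
    then have "?D0 \<in> indeps M" using C by (simp add: matroid_circuit_def)
    then have "matroid_rank M D = card ?D0"
      using matroid_rank_indep[OF M] rank_cl[OF M, of ?D0] Cg by (auto simp: D_def)
    also have "\<dots> = card C - 2" using C ef fin by (simp add: card_Diff_subset)
    finally show ?thesis .
  qed
  have c2: "2 \<le> card C" using card_mono[OF fin, of "{e, f}"] C ef by simp
  \<comment> \<open>Otherwise \<open>D\<close>, of rank \<open>card C - 2\<close>, would contain
    \<open>C - {y}\<close>, which is independent of size \<open>card C - 1\<close>.\<close>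
  have notin: "x \<notin> D" if x: "x \<in> C" "C = insert x (insert y ?D0)" "y \<in> C" for x y
  proof
    assume "x \<in> D"
    then have "C - {y} \<subseteq> D" using x D0D by auto
    then have "matroid_rank M (C - {y}) \<le> card C - 2" using matroid_rank_mono[OF M] rD by metis
    then show False using circuit_rank[OF M C(1) x(3)] c2 by simp
  qed
  have eD: "e \<notin> D" "f \<notin> D" using notin[of e f] notin[of f e] C by auto
  \<comment> \<open>\<open>L\<close> and \<open>D\<close> together span the closure of
    \<open>C\<close>, of rank \<open>card C - 1\<close>, so the modular law gives
    \<open>L \<inter> D\<close> the rank 2 + (\<open>card C\<close> - 2) - (\<open>card C\<close> -
    1) = 1.\<close>
  have "matroid_rank M (flat_join M L D) = matroid_rank M C"
  proof (rule antisym)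
    have Ccl: "C \<subseteq> matroid_cl M C" using subset_cl[OF Cg] .
    have "p \<subseteq> matroid_cl M C" "q \<subseteq> matroid_cl M C"
      using cl_mono[OF M, of "{e}" C] cl_mono[OF M, of "{f}" C] e f C by auto
    then have "L \<subseteq> matroid_cl M C" using cl_least[OF M flat_cl[OF M Cg]] by (simp add: L_def)
    moreover have "D \<subseteq> matroid_cl M C" using cl_mono[OF M, of ?D0 C] by (auto simp: D_def)
    ultimately have "flat_join M L D \<subseteq> matroid_cl M C" using cl_least[OF M flat_cl[OF M Cg]] by simp
    then show "matroid_rank M (flat_join M L D) \<le> matroid_rank M C"
      using matroid_rank_mono[OF M] rank_cl[OF M Cg] by metis
    have "C \<subseteq> L \<union> D" using e f pL D0D by auto
    also have "\<dots> \<subseteq> flat_join M L D" using L D by (intro subset_cl) (auto simp: matroid_flat_def)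
    finally show "matroid_rank M C \<le> matroid_rank M (flat_join M L D)" by (rule matroid_rank_mono[OF M])
  qed
  then have "matroid_rank M (L \<inter> D) = 1"
    using modular[of L D] L D rD circuit_rank(1)[OF M C(1,2)] c2 by simp
  then have "matroid_point M (L \<inter> D)" using flat_Int[OF M L(1) D] by (simp add: matroid_point_def)
  moreover have "L \<inter> D \<noteq> p" "L \<inter> D \<noteq> q" using e f eD by auto
  ultimately show ?thesis unfolding L_def by (intro exI[of _ "flat_join M p q \<inter> D"]) auto
qed

text \<open>A loop is a dependent singleton, so it lies in no larger circuit, while connectedness
  puts it in one with another element. Two elements are demanded because a single loop counts as
  connected.\<close>

lemma connected_loopless:
  assumes M: "matroid M" and con: "matroid_connected M" and ef: "e \<in> ground M" "f \<in> ground M" "e \<noteq> f"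
  shows "matroid_cl M {} = {}"
proof (rule ccontr)
  assume "matroid_cl M {} \<noteq> {}"
  then obtain x where x: "x \<in> matroid_cl M {}" by auto
  obtain y where y: "y \<in> ground M" "y \<noteq> x" using ef by metis
  obtain C where C: "matroid_circuit M C" "x \<in> C" "y \<in> C"
    using con y in_clD[OF x] unfolding matroid_connected_def by metis
  then have "{x} \<subset> C" using y by auto
  then have "{x} \<in> indeps M" using C by (simp add: matroid_circuit_def)
  then show False using matroid_rank_indep[OF M] matroid_rank_empty[OF M] in_clD[OF x] by fastforce
qed

lemma rich_flats_of_matroid:
  assumes M: "matroid M" and con: "matroid_connected M" and mod: "matroid_modular M"
    and four: "\<exists>L. matroid_line M L \<and> card {P. matroid_point M P \<and> P \<subseteq> L} \<ge> 4"
  shows "rich_flats {F. matroid_flat M F} (flat_join M) (matroid_rank M)"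
proof -
  interpret modular_flats "{F. matroid_flat M F}" "flat_join M" "matroid_rank M"
    by (rule modular_flats_of_matroid[OF M mod])
  have pt_iff: "pt x \<longleftrightarrow> matroid_point M x" for x by (simp add: pt_def matroid_point_def)
  interpret three_pt_flats "{F. matroid_flat M F}" "flat_join M" "matroid_rank M"
    by unfold_locales (use connected_third_point[OF M con mod] pt_iff in auto)
  obtain L where L: "matroid_line M L" "card {P. matroid_point M P \<and> P \<subseteq> L} \<ge> 4" using four by blast
  have "rich L" unfolding rich_def
  proof (intro allI)
    fix x y z
    have "\<not> {P. matroid_point M P \<and> P \<subseteq> L} \<subseteq> {x, y, z}"
      using L(2) card_mono[of "{x, y, z}" "{P. matroid_point M P \<and> P \<subseteq> L}"] card_length[of "[x, y, z]"]
      by auto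
    then show "\<exists>w. pt w \<and> w \<le> L \<and> w \<noteq> x \<and> w \<noteq> y \<and> w \<noteq> z" using pt_iff by auto
  qed
  moreover have "ln L" using L by (simp add: ln_def matroid_line_def)
  ultimately show ?thesis
    by unfold_locales (use all_rich in blast)
qed

section \<open>Targets\<close>

lemma rank_restrict: "Y \<subseteq> X \<Longrightarrow> matroid_rank (matroid_restrict M X) Y = matroid_rank M Y"
proof -
  assume "Y \<subseteq> X"
  then have "{I \<in> {I \<in> indeps M. I \<subseteq> X}. I \<subseteq> Y} = {I \<in> indeps M. I \<subseteq> Y}" by auto
  then show ?thesis by (simp add: matroid_rank_def matroid_restrict_def)
qed

lemma cl_restrict:
  assumes "X \<subseteq> ground M" "Y \<subseteq> X"
  shows "matroid_cl (matroid_restrict M X) Y = matroid_cl M Y \<inter> X"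
proof -
  have "ground (matroid_restrict M X) = X" by (simp add: matroid_restrict_def)
  then show ?thesis using assms by (auto simp: matroid_cl_def rank_restrict)
qed

lemma flat_restrict:
  assumes M: "matroid M" and X: "X \<subseteq> ground M" and F: "matroid_flat M F"
  shows "matroid_flat (matroid_restrict M X) (F \<inter> X)"
proof -
  have "matroid_cl M (F \<inter> X) \<subseteq> F" using cl_least[OF M F] by simp
  moreover have "F \<inter> X \<subseteq> matroid_cl M (F \<inter> X)" using X by (intro subset_cl) auto
  ultimately have "matroid_cl M (F \<inter> X) \<inter> X = F \<inter> X" by auto
  then show ?thesis using cl_restrict[OF X, of "F \<inter> X"]
    by (simp add: matroid_flat_def matroid_restrict_def)
qed

text \<open>Since \<open>X\<close> is closed, the closure of \<open>G\<close> in \<open>M\<close>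
  stays inside \<open>X\<close> and agrees with that in the restriction.\<close>

lemma flat_of_restrict:
  assumes M: "matroid M" and X: "matroid_flat M X" and G: "matroid_flat (matroid_restrict M X) G"
  shows "matroid_flat M G"
proof -
  have XG: "X \<subseteq> ground M" "G \<subseteq> X" using X G by (auto simp: matroid_flat_def matroid_restrict_def)
  have "matroid_cl M G \<inter> X = G" using G cl_restrict[OF XG] by (simp add: matroid_flat_def)
  then show ?thesis using cl_least[OF M X XG(2)] XG by (auto simp: matroid_flat_def)
qed

lemma monochromatic_empty [simp]: "monochromatic c {}"
  by (simp add: monochromatic_def)

lemma monochromatic_subset: "\<lbrakk>monochromatic c Y; X \<subseteq> Y\<rbrakk> \<Longrightarrow> monochromatic c X"
  unfolding monochromatic_def by blast

text \<open>A form with indexed chain steps, for use in proofs; an empty set counts as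
  monochromatic, which settles the empty steps.\<close>

lemma is_target_iff:
  "is_target M c \<longleftrightarrow> (\<exists>(k::nat) F. F 0 = matroid_cl M {} \<and> F k = ground M \<and>
     (\<forall>i\<le>k. matroid_flat M (F i)) \<and> (\<forall>i<k. F i \<subseteq> F (Suc i)) \<and>
     monochromatic c (F 0) \<and> (\<forall>i<k. monochromatic c (F (Suc i) - F i)))"
proof -
  have "(\<forall>X \<in> insert (F 0) {F (Suc i) - F i | i. i < k}. X \<noteq> {} \<longrightarrow> monochromatic c X) \<longleftrightarrow>
      monochromatic c (F 0) \<and> (\<forall>i<k. monochromatic c (F (Suc i) - F i))"
    for k :: nat and F :: "nat \<Rightarrow> 'a set"
  proof -
    have "(Y \<noteq> {} \<longrightarrow> monochromatic c Y) \<longleftrightarrow> monochromatic c Y" for Y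
      by (cases "Y = {}") auto
    then show ?thesis by (simp only:) auto
  qed
  then show ?thesis unfolding is_target_def by (simp only:)
qed

lemma is_targetE:
  assumes "is_target M c"
  obtains k F where "F 0 = matroid_cl M {}" "F k = ground M" "\<forall>i\<le>k. matroid_flat M (F i)"
    "\<forall>i<k. F i \<subseteq> F (Suc i)" "monochromatic c (F 0)" "\<forall>i<k. monochromatic c (F (Suc i) - F i)"
  using assms unfolding is_target_iff by (elim exE conjE) (rule that)

text \<open>The chain of \<open>M\<close>, intersected with \<open>X\<close>, serves for the
  restriction.\<close>

lemma is_target_restrict:
  assumes M: "matroid M" and X: "X \<subseteq> ground M" and c: "is_target M c"
  shows "is_target (matroid_restrict M X) (restrict c X)"
proof -
  obtain k F where F: "F 0 = matroid_cl M {}" "F k = ground M" "\<forall>i\<le>k. matroid_flat M (F i)"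
    "\<forall>i<k. F i \<subseteq> F (Suc i)" "monochromatic c (F 0)" "\<forall>i<k. monochromatic c (F (Suc i) - F i)"
    using is_targetE[OF c] .
  let ?G = "\<lambda>i. F i \<inter> X"
  have mono: "monochromatic (restrict c X) (Y \<inter> X)" if "monochromatic c Y" for Y
    using that by (auto simp: monochromatic_def)
  have "monochromatic (restrict c X) (?G (Suc i) - ?G i)" if "i < k" for i
    using monochromatic_subset[OF mono, of "F (Suc i) - F i" "?G (Suc i) - ?G i"] F(6) that by auto
  moreover have "matroid_flat (matroid_restrict M X) (?G i)" if "i \<le> k" for i
    using flat_restrict[OF M X] F(3) that by blast
  moreover have "?G i \<subseteq> ?G (Suc i)" if "i < k" for i using F(4) that by blast
  moreover have "?G 0 = matroid_cl (matroid_restrict M X) {}"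
    using F(1) cl_restrict[OF X, of "{}"] by simp
  moreover have "?G k = ground (matroid_restrict M X)"
    using F(2) X by (auto simp: matroid_restrict_def)
  ultimately show ?thesis unfolding is_target_iff using mono[OF F(5)]
    by (intro exI[of _ k] exI[of _ ?G]) blast
qed

text \<open>\<open>G\<close> is the last flat of the chain that does not contain \<open>X\<close>;
  what it omits of \<open>X\<close> lies in the next difference. It exists because the chain starts
  with the closure of the empty set.\<close>

lemma is_target_peel:
  assumes c: "is_target N c" and X: "X \<subseteq> ground N" "\<not> X \<subseteq> matroid_cl N {}"
  obtains G where "matroid_flat N G" "\<not> X \<subseteq> G" "monochromatic c (X - G)"
proof -
  obtain k F where F: "F 0 = matroid_cl N {}" "F k = ground N" "\<forall>i\<le>k. matroid_flat N (F i)"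
    "\<forall>i<k. monochromatic c (F (Suc i) - F i)"
    using is_targetE[OF c] .
  define j where "j = (LEAST i. X \<subseteq> F i)"
  have "X \<subseteq> F k" using F(2) X(1) by simp
  then have j: "X \<subseteq> F j" "j \<le> k" unfolding j_def by (rule LeastI, rule Least_le)
  obtain i where i: "j = Suc i" using j(1) X(2) F(1) by (cases j) simp_all
  then have Xi: "\<not> X \<subseteq> F i" using not_less_Least[of i "\<lambda>i. X \<subseteq> F i"] by (simp add: j_def[symmetric])
  have "monochromatic c (F (Suc i) - F i)" using F(4) i j(2) by simp
  moreover have "X - F i \<subseteq> F (Suc i) - F i" using i j(1) by auto
  ultimately have "monochromatic c (X - F i)" by (rule monochromatic_subset)
  moreover have "matroid_flat N (F i)" using F(3) i j(2) by simp
  ultimately show ?thesis using that[of "F i"] Xi by blast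
qed

text \<open>Each flat is peeled down to the empty one, the rank dropping at every step; the
  recursion appends \<open>F\<close> to the chain that ends in \<open>H\<close>.\<close>

lemma is_targetI:
  assumes M: "matroid M" and loopless: "matroid_cl M {} = {}"
    and peel: "\<And>F. \<lbrakk>matroid_flat M F; F \<noteq> {}\<rbrakk> \<Longrightarrow> \<exists>H. matroid_flat M H \<and> H \<subset> F \<and> monochromatic c (F - H)"
  shows "is_target M c"
proof -
  have chain: "\<exists>k Fs. Fs 0 = {} \<and> Fs k = F \<and> (\<forall>i\<le>k. matroid_flat M (Fs i)) \<and>
      (\<forall>i<k. Fs i \<subseteq> Fs (Suc i) \<and> monochromatic c (Fs (Suc i) - Fs i))" if "matroid_flat M F" for F
    using that
  proof (induction "matroid_rank M F" arbitrary: F rule: less_induct)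
    case less
    show ?case
    proof (cases "F = {}")
      case True
      then show ?thesis using less.prems by (intro exI[of _ 0] exI[of _ "\<lambda>_. {}"]) auto
    next
      case False
      obtain H where H: "matroid_flat M H" "H \<subset> F" "monochromatic c (F - H)"
        using peel[OF less.prems False] by blast
      obtain k Fs where Fs: "Fs 0 = {}" "Fs k = H" "\<And>i. i \<le> k \<Longrightarrow> matroid_flat M (Fs i)"
        "\<And>i. i < k \<Longrightarrow> Fs i \<subseteq> Fs (Suc i) \<and> monochromatic c (Fs (Suc i) - Fs i)"
        using less.hyps[OF flat_rank_strict[OF M H(1) less.prems H(2)] H(1)] by metis
      show ?thesis
        using Fs H less.prems
        by (intro exI[of _ "Suc k"] exI[of _ "Fs(Suc k := F)"]) (auto simp: less_Suc_eq le_Suc_eq)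
    qed
  qed
  have "matroid_flat M (ground M)"
    using cl_ground[of M "ground M"] subset_cl[of "ground M" M] by (auto simp: matroid_flat_def)
  then show ?thesis using chain[of "ground M"] loopless monochromatic_empty
    unfolding is_target_iff by metis
qed

section \<open>Coloured matroids whose lines are targets\<close>

lemma target_of_lines:
  fixes M :: "'a matroid_struct" and c :: "'a \<Rightarrow> 'c"
  assumes M: "matroid M" and con: "matroid_connected M" and mod: "matroid_modular M"
    and four: "\<exists>L. matroid_line M L \<and> card {P. matroid_point M P \<and> P \<subseteq> L} \<ge> 4"
    and lines: "\<And>L. matroid_line M L \<Longrightarrow> is_target (matroid_restrict M L) (restrict c L)"
  shows "is_target M c"
proof -
  interpret rich_flats "{F. matroid_flat M F}" "flat_join M" "matroid_rank M"
    by (rule rich_flats_of_matroid[OF M con mod four])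
  have ln_iff: "ln L \<longleftrightarrow> matroid_line M L" for L by (simp add: ln_def matroid_line_def)
  obtain L0 where L0: "ln L0" using four ln_iff by blast
  have loopless: "matroid_cl M {} = {}"
  proof -
    obtain B where B: "B \<subseteq> L0" "card B = 2" using obtain_basis[OF M, of L0] ln_rk[OF L0] by metis
    have "L0 \<subseteq> ground M" using iffD1[OF ln_iff L0] unfolding matroid_line_def matroid_flat_def by blast
    then have "\<exists>e\<in>ground M. \<exists>f\<in>ground M. e \<noteq> f" using B by (auto simp: card_2_iff)
    then show ?thesis using connected_loopless[OF M con] by blast
  qed
  have empty_flat: "matroid_flat M {}" by (simp add: matroid_flat_def loopless)
  have rank_pos: "0 < matroid_rank M F" if "matroid_flat M F" "F \<noteq> {}" for F
    using flat_rank_strict[OF M empty_flat that(1)] that(2) by (simp add: psubset_eq)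
  \<comment> \<open>This is used both for a whole line, \<open>X = L\<close>, and for a point
    \<open>X\<close> on it.\<close>
  have peel: "\<exists>G. matroid_flat M G \<and> G \<subset> X \<and> monochromatic c (X - G)"
    if L: "ln L" and X: "matroid_flat M X" "X \<subseteq> L" "X \<noteq> {}" for L X
  proof -
    have Lf: "matroid_flat M L" "matroid_line M L" using L ln_iff by (auto simp: matroid_line_def)
    have Lg: "L \<subseteq> ground M" using Lf by (simp add: matroid_flat_def)
    obtain G where G: "matroid_flat (matroid_restrict M L) G" "\<not> X \<subseteq> G"
        "monochromatic (restrict c L) (X - G)"
    proof (rule is_target_peel[OF lines[OF Lf(2)]])
      show "X \<subseteq> ground (matroid_restrict M L)" using X by (simp add: matroid_restrict_def)
      show "\<not> X \<subseteq> matroid_cl (matroid_restrict M L) {}"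
        using cl_restrict[OF Lg, of "{}"] loopless X by simp
    qed
    have "matroid_flat M (X \<inter> G)" using flat_Int[OF M X(1) flat_of_restrict[OF M Lf(1) G(1)]] .
    moreover obtain a where "\<And>x. x \<in> X - G \<Longrightarrow> restrict c L x = a"
      using G(3) unfolding monochromatic_def by blast
    then have "c x = a" if "x \<in> X - X \<inter> G" for x using that X(2) by (metis Diff_Int_distrib Diff_iff IntI restrict_apply' subsetD)
    then have "monochromatic c (X - X \<inter> G)" unfolding monochromatic_def by blast
    ultimately show ?thesis using G(2) by blast
  qed
  have rank0: "F = {}" if "matroid_flat M F" "matroid_rank M F = 0" for F
    using rank_pos[OF that(1)] that(2) by (cases "F = {}") auto
  have flat_pt: "matroid_flat M x" if "pt x" for x using pt_FL[OF that] by simp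
  have pt_ne: "x \<noteq> {}" if "pt x" for x
    using pt_rk[OF that] matroid_rank_empty[OF M] by auto
  \<comment> \<open>Peeling a point, placed on a line with another point \<open>y\<close>, leaves a
    flat of rank 0. It is empty as there are no loops, so all elements of the point share one
    colour.\<close>
  have pt_mono: "monochromatic c x" if x: "pt x" for x
  proof -
    obtain y where y: "pt y" "y \<noteq> x" using other_pt[OF L0 x] by metis
    have "x \<subseteq> flat_join M x y" using le_jn(1)[OF pt_FL[OF x] pt_FL[OF y(1)]] .
    then obtain G where G: "matroid_flat M G" "G \<subset> x" "monochromatic c (x - G)"
      using peel[OF ln_join[OF x y(1) y(2)[symmetric]] flat_pt[OF x] _ pt_ne[OF x]] by blast
    have "G = {}" using rank0[OF G(1)] flat_rank_strict[OF M G(1) flat_pt[OF x] G(2)] pt_rk[OF x] by simp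
    then show ?thesis using G by simp
  qed
  define d where "d = (\<lambda>x. c (SOME e. e \<in> x))"
  have d: "c e = d x" if "pt x" "e \<in> x" for e x
    using pt_mono[OF that(1)] someI[of "\<lambda>e. e \<in> x", OF that(2)] that(2)
    unfolding d_def monochromatic_def by metis
  have maj: "\<exists>a. maj d L a" if L: "ln L" for L
  proof -
    have Lf: "matroid_flat M L" using ln_FL[OF L] by simp
    have "L \<noteq> {}" using ln_rk[OF L] matroid_rank_empty[OF M] by auto
    then obtain G a where G: "matroid_flat M G" "G \<subset> L" and a: "\<And>e. e \<in> L - G \<Longrightarrow> c e = a"
      using peel[OF L Lf order.refl] unfolding monochromatic_def by blast
    have rG: "matroid_rank M G \<le> 1" using flat_rank_strict[OF M G(1) Lf G(2)] ln_rk[OF L] by simp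
    \<comment> \<open>\<open>G\<close> has rank at most 1, so it is a point or empty, and it serves
      as the exception.\<close>
    have "d x = a" if x: "pt x" "x \<subseteq> L" "x \<noteq> G" for x
    proof -
      have "\<not> x \<subseteq> G" using flat_eqI[OF pt_FL[OF x(1)], of G] x(3) G(1) rG pt_rk[OF x(1)] by auto
      then obtain e where "e \<in> x" "e \<notin> G" by auto
      then show ?thesis using a[of e] d[OF x(1)] x(2) by auto
    qed
    then show ?thesis unfolding maj_def by blast
  qed
  show ?thesis
  proof (rule is_targetI[OF M loopless])
    fix F assume F: "matroid_flat M F" "F \<noteq> {}"
    obtain H a where H: "matroid_flat M H" "H \<subseteq> F" "matroid_rank M F = Suc (matroid_rank M H)"
      and a: "\<And>x. \<lbrakk>pt x; x \<subseteq> F; \<not> x \<subseteq> H\<rbrakk> \<Longrightarrow> d x = a"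
      using hyperplane_monochromatic[of F d] F rank_pos[OF F] maj by auto
    \<comment> \<open>An element of \<open>F - H\<close> lies in the point it spans, which is below
      \<open>F\<close> but not below \<open>H\<close>.\<close>
    have "c e = a" if e: "e \<in> F - H" for e
    proof -
      have eg: "e \<in> ground M" using e F by (auto simp: matroid_flat_def)
      have p: "pt (matroid_cl M {e})"
        using cl_singleton_point[OF M eg] loopless by (simp add: pt_def matroid_point_def)
      have ep: "e \<in> matroid_cl M {e}" using subset_cl[of "{e}" M] eg by simp
      have "matroid_cl M {e} \<subseteq> F" using cl_least[OF M F(1), of "{e}"] e by simp
      then show ?thesis using a[OF p] d[OF p ep] ep e by auto
    qed
    then have "monochromatic c (F - H)" unfolding monochromatic_def by blast
    moreover have "H \<noteq> F" using H(3) by auto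
    ultimately show "\<exists>H. matroid_flat M H \<and> H \<subset> F \<and> monochromatic c (F - H)" using H by blast
  qed
qed

theorem theorem7p9:
  fixes M :: "'a matroid_struct" and c :: "'a \<Rightarrow> 'c"
  assumes "matroid M"
    and "matroid_connected M"
    and "matroid_modular M"
    and "\<exists>L. matroid_line M L \<and> card {P. matroid_point M P \<and> P \<subseteq> L} \<ge> 4"
  shows "is_target M c \<longleftrightarrow>
    (\<forall>L. matroid_line M L \<longrightarrow> is_target (matroid_restrict M L) (restrict c L))"
proof
  assume "is_target M c"
  then show "\<forall>L. matroid_line M L \<longrightarrow> is_target (matroid_restrict M L) (restrict c L)"
    using is_target_restrict[OF assms(1)] unfolding matroid_line_def matroid_flat_def by blast
next
  assume "\<forall>L. matroid_line M L \<longrightarrow> is_target (matroid_restrict M L) (restrict c L)"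
  then show "is_target M c" using target_of_lines[OF assms] by blast
qed

end
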